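(* Let $S$ be a semiring. Every flat right $S$-semimodule is uniformly flat.
   Context: A semiring $(S,+,\cdot,0,1)$ consists of a commutative monoid $(S,+,0)$ and a monoid $(S,\cdot,1)$ such that $\cdot$ distributes over $+$ on both sides and $0s=0=s0$ for all $s$; throughout $1\neq 0$. A right $S$-semimodule is a commutative monoid $(M,+,0)$ with a right action satisfying $(ms)s'=m(ss')$, $(m+m')s=ms+m's$, $m(s+s')=ms+ms'$, $m1=m$, $m0=0=0s$; left semimodules are defined analogously. Morphisms are the $S$-linear (additive, action-preserving) maps. Abelian monoids are identified with semimodules over $\mathbb{N}_0$. A right $S$-semimodule $P$ is projective if $\mathrm{Hom}_S(P,g)$ is surjective for every surjective $S$-linear map $g$. A right $S$-semimodule $F$ is flat if $F=\varinjlim F_i$ is a directed limit (filtered colimit over a directed set) of finitely presented projective right $S$-semimodules (finitely presented in the sense of universal algebra). For a morphism $\gamma:M\to N$ put $\mathrm{Ker}(\gamma)=\{m\in M\mid\gamma(m)=0\}$. $\gamma$ is $k$-uniform if $\gamma(m_1)=\gamma(m_2)$ implies $m_1+k_1=m_2+k_2$ for some $k_1,k_2\in\mathrm{Ker}(\gamma)$. A sequence $L\xrightarrow{f}M\xrightarrow{g}N$ is exact if $f(L)=\mathrm{Ker}(g)$ and $g$ is $k$-uniform; a longer sequence is exact if each three-term piece is. For an Abelian monoid $G$, a map $\beta:F\times N\to G$ ($F$ right, $N$ left $S$-semimodule) is $S$-balanced if it is a monoid morphism in each variable and $\beta(fs,n)=\beta(f,sn)$; $F\otimes_S N$ is the Abelian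 monoid with the universal $S$-balanced map out of $F\times N$. A right $S$-semimodule $F$ is uniformly flat if for every exact sequence of left $S$-semimodules $0\to L\xrightarrow{f}M\xrightarrow{g}N\to 0$ the sequence of Abelian monoids $0\to F\otimes_S L\xrightarrow{\mathrm{id}_F\otimes f}F\otimes_S M\xrightarrow{\mathrm{id}_F\otimes g}F\otimes_S N\to 0$ is exact. *)

theory Defs
  imports "HOL-Algebra.Elementary_Groups" "HOL-Algebra.Module" "HOL-Library.Multiset"
begin

section \<open>Semimodules over a semiring\<close>

text \<open>
  Semimodules reuse the record \<^type>\<open>module\<close> of HOL-Algebra, whose fields \<open>mult\<close> and \<open>one\<close> play no
  role (as in the library's modules).  For a right semimodule, \<open>a \<odot>\<^bsub>M\<^esub> x\<close> stands for the right
  action \<open>x a\<close>, whence the shape of \<open>right_assoc\<close>.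
\<close>

locale presemimodule = R?: semiring R + M?: abelian_monoid M
  for R (structure) and M (structure) +
  assumes smult_closed [simp, intro]:
      "\<lbrakk>a \<in> carrier R; x \<in> carrier M\<rbrakk> \<Longrightarrow> a \<odot>\<^bsub>M\<^esub> x \<in> carrier M"
    and smult_l_distr:
      "\<lbrakk>a \<in> carrier R; b \<in> carrier R; x \<in> carrier M\<rbrakk>
        \<Longrightarrow> (a \<oplus> b) \<odot>\<^bsub>M\<^esub> x = a \<odot>\<^bsub>M\<^esub> x \<oplus>\<^bsub>M\<^esub> b \<odot>\<^bsub>M\<^esub> x"
    and smult_r_distr:
      "\<lbrakk>a \<in> carrier R; x \<in> carrier M; y \<in> carrier M\<rbrakk>
        \<Longrightarrow> a \<odot>\<^bsub>M\<^esub> (x \<oplus>\<^bsub>M\<^esub> y) = a \<odot>\<^bsub>M\<^esub> x \<oplus>\<^bsub>M\<^esub> a \<odot>\<^bsub>M\<^esub> y"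
    and smult_one [simp]: "x \<in> carrier M \<Longrightarrow> \<one> \<odot>\<^bsub>M\<^esub> x = x"
    and smult_l_null [simp]: "x \<in> carrier M \<Longrightarrow> \<zero> \<odot>\<^bsub>M\<^esub> x = \<zero>\<^bsub>M\<^esub>"
    and smult_r_null [simp]: "a \<in> carrier R \<Longrightarrow> a \<odot>\<^bsub>M\<^esub> \<zero>\<^bsub>M\<^esub> = \<zero>\<^bsub>M\<^esub>"

locale right_semimodule = presemimodule +
  assumes right_assoc:
    "\<lbrakk>a \<in> carrier R; b \<in> carrier R; x \<in> carrier M\<rbrakk>
      \<Longrightarrow> b \<odot>\<^bsub>M\<^esub> (a \<odot>\<^bsub>M\<^esub> x) = (a \<otimes> b) \<odot>\<^bsub>M\<^esub> x"

locale left_semimodule = presemimodule +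
  assumes left_assoc:
    "\<lbrakk>a \<in> carrier R; b \<in> carrier R; x \<in> carrier M\<rbrakk>
      \<Longrightarrow> a \<odot>\<^bsub>M\<^esub> (b \<odot>\<^bsub>M\<^esub> x) = (a \<otimes> b) \<odot>\<^bsub>M\<^esub> x"

definition lin_hom ::
    "('r, 'z) ring_scheme \<Rightarrow> ('r, 'a) module \<Rightarrow> ('r, 'b) module \<Rightarrow> ('a \<Rightarrow> 'b) set"
  where "lin_hom R M N = {f \<in> hom (add_monoid M) (add_monoid N).
           \<forall>a\<in>carrier R. \<forall>x\<in>carrier M. f (a \<odot>\<^bsub>M\<^esub> x) = a \<odot>\<^bsub>N\<^esub> f x}"

definition lin_iso ::
    "('r, 'z) ring_scheme \<Rightarrow> ('r, 'a) module \<Rightarrow> ('r, 'b) module \<Rightarrow> ('a \<Rightarrow> 'b) set"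
  where "lin_iso R M N = {f \<in> lin_hom R M N. bij_betw f (carrier M) (carrier N)}"

lemma lin_homI:
  assumes "\<And>x. x \<in> carrier M \<Longrightarrow> f x \<in> carrier N"
    and "\<And>x y. \<lbrakk>x \<in> carrier M; y \<in> carrier M\<rbrakk> \<Longrightarrow> f (x \<oplus>\<^bsub>M\<^esub> y) = f x \<oplus>\<^bsub>N\<^esub> f y"
    and "\<And>a x. \<lbrakk>a \<in> carrier R; x \<in> carrier M\<rbrakk> \<Longrightarrow> f (a \<odot>\<^bsub>M\<^esub> x) = a \<odot>\<^bsub>N\<^esub> f x"
  shows "f \<in> lin_hom R M N"
  using assms by (auto simp: lin_hom_def hom_def)

lemma lin_homD:
  assumes "f \<in> lin_hom R M N"
  shows "x \<in> carrier M \<Longrightarrow> f x \<in> carrier N"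
    and "\<lbrakk>x \<in> carrier M; y \<in> carrier M\<rbrakk> \<Longrightarrow> f (x \<oplus>\<^bsub>M\<^esub> y) = f x \<oplus>\<^bsub>N\<^esub> f y"
    and "\<lbrakk>a \<in> carrier R; x \<in> carrier M\<rbrakk> \<Longrightarrow> f (a \<odot>\<^bsub>M\<^esub> x) = a \<odot>\<^bsub>N\<^esub> f x"
  using assms by (auto simp: lin_hom_def hom_def)

lemma lin_hom_zero:
  assumes "f \<in> lin_hom R M N" "presemimodule R M" "presemimodule R N"
  shows "f \<zero>\<^bsub>M\<^esub> = \<zero>\<^bsub>N\<^esub>"
proof -
  interpret M: presemimodule R M by fact
  interpret N: presemimodule R N by fact
  have "f \<zero>\<^bsub>M\<^esub> = f (\<zero>\<^bsub>R\<^esub> \<odot>\<^bsub>M\<^esub> \<zero>\<^bsub>M\<^esub>)" by simp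
  also have "\<dots> = \<zero>\<^bsub>R\<^esub> \<odot>\<^bsub>N\<^esub> f \<zero>\<^bsub>M\<^esub>"
    using lin_homD(3)[OF assms(1)] by blast
  also have "\<dots> = \<zero>\<^bsub>N\<^esub>"
    using lin_homD(1)[OF assms(1)] by simp
  finally show ?thesis .
qed

lemma lin_hom_comp:
  assumes "f \<in> lin_hom R M N" "g \<in> lin_hom R N P"
  shows "(\<lambda>x. g (f x)) \<in> lin_hom R M P"
  using assms by (auto intro!: lin_homI simp: lin_homD)


section \<open>Exactness\<close>

text \<open>
  Exactness concerns the underlying Abelian monoids only.  They are commutative monoids in the
  sense of HOL-Algebra (a semimodule \<open>M\<close> enters as \<open>add_monoid M\<close>), so that \<open>\<otimes>\<close> below is the
  addition and \<open>\<one>\<close> the zero element.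
\<close>

definition k_uniform :: "('a, 'y) monoid_scheme \<Rightarrow> ('b, 'z) monoid_scheme \<Rightarrow> ('a \<Rightarrow> 'b) \<Rightarrow> bool"
  where "k_uniform M N g \<longleftrightarrow>
    (\<forall>m1\<in>carrier M. \<forall>m2\<in>carrier M. g m1 = g m2 \<longrightarrow>
      (\<exists>k1\<in>kernel M N g. \<exists>k2\<in>kernel M N g. m1 \<otimes>\<^bsub>M\<^esub> k1 = m2 \<otimes>\<^bsub>M\<^esub> k2))"

definition exact_at ::
    "('a, 'x) monoid_scheme \<Rightarrow> ('a \<Rightarrow> 'b) \<Rightarrow> ('b, 'y) monoid_scheme \<Rightarrow> ('b \<Rightarrow> 'c) \<Rightarrow>
     ('c, 'z) monoid_scheme \<Rightarrow> bool"
  where "exact_at L f M g N \<longleftrightarrow> f ` carrier L = kernel M N g \<and> k_uniform M N g"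

definition short_exact ::
    "('a, 'x) monoid_scheme \<Rightarrow> ('a \<Rightarrow> 'b) \<Rightarrow> ('b, 'y) monoid_scheme \<Rightarrow> ('b \<Rightarrow> 'c) \<Rightarrow>
     ('c, 'z) monoid_scheme \<Rightarrow> bool"
  where "short_exact L f M g N \<longleftrightarrow>
    exact_at (singleton_group ()) (\<lambda>_. \<one>\<^bsub>L\<^esub>) L f M \<and>
    exact_at L f M g N \<and>
    exact_at M g N (\<lambda>_. ()) (singleton_group ())"


section \<open>Free, finitely presented and projective right semimodules\<close>

text \<open>The free right semimodule on \<open>X\<close>: finitely supported functions from \<open>X\<close> to \<open>R\<close>.\<close>

definition free_semimod :: "('r, 'z) ring_scheme \<Rightarrow> 'x set \<Rightarrow> ('r, 'x \<Rightarrow> 'r) module"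
  where "free_semimod R X =
    \<lparr>carrier = {v. (\<forall>x\<in>X. v x \<in> carrier R) \<and> (\<forall>x. x \<notin> X \<longrightarrow> v x = \<zero>\<^bsub>R\<^esub>) \<and>
                   finite {x. v x \<noteq> \<zero>\<^bsub>R\<^esub>}},
     monoid.mult = undefined, one = undefined,
     zero = (\<lambda>_. \<zero>\<^bsub>R\<^esub>),
     add = (\<lambda>v w x. v x \<oplus>\<^bsub>R\<^esub> w x),
     smult = (\<lambda>a v x. v x \<otimes>\<^bsub>R\<^esub> a)\<rparr>"

text \<open>The congruence on \<open>M\<close> generated by \<open>E\<close>.\<close>

inductive_set gen_cong :: "('r, 'z) ring_scheme \<Rightarrow> ('r, 'a) module \<Rightarrow> ('a \<times> 'a) set \<Rightarrow> ('a \<times> 'a) set"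
  for R :: "('r, 'z) ring_scheme" and M :: "('r, 'a) module" and E :: "('a \<times> 'a) set"
  where
    base: "(x, y) \<in> E \<Longrightarrow> (x, y) \<in> gen_cong R M E"
  | refl: "x \<in> carrier M \<Longrightarrow> (x, x) \<in> gen_cong R M E"
  | sym: "(x, y) \<in> gen_cong R M E \<Longrightarrow> (y, x) \<in> gen_cong R M E"
  | trans: "\<lbrakk>(x, y) \<in> gen_cong R M E; (y, z) \<in> gen_cong R M E\<rbrakk> \<Longrightarrow> (x, z) \<in> gen_cong R M E"
  | add: "\<lbrakk>(x, y) \<in> gen_cong R M E; (x', y') \<in> gen_cong R M E\<rbrakk>
          \<Longrightarrow> (x \<oplus>\<^bsub>M\<^esub> x', y \<oplus>\<^bsub>M\<^esub> y') \<in> gen_cong R M E"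
  | smult: "\<lbrakk>a \<in> carrier R; (x, y) \<in> gen_cong R M E\<rbrakk>
          \<Longrightarrow> (a \<odot>\<^bsub>M\<^esub> x, a \<odot>\<^bsub>M\<^esub> y) \<in> gen_cong R M E"

text \<open>
  Finite presentation in the sense of universal algebra: \<open>P\<close> is, via the surjection \<open>p\<close>, the
  quotient of a free semimodule on finitely many generators by a finitely generated congruence.
\<close>

definition finitely_presented :: "('r, 'z) ring_scheme \<Rightarrow> ('r, 'a) module \<Rightarrow> bool"
  where "finitely_presented R P \<longleftrightarrow> right_semimodule R P \<and>
    (\<exists>n E p.
      finite E \<and>
      E \<subseteq> carrier (free_semimod R {..<n::nat}) \<times> carrier (free_semimod R {..<n}) \<and>
      p \<in> lin_hom R (free_semimod R {..<n}) P \<and>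
      p ` carrier (free_semimod R {..<n}) = carrier P \<and>
      (\<forall>v\<in>carrier (free_semimod R {..<n}). \<forall>w\<in>carrier (free_semimod R {..<n}).
        p v = p w \<longleftrightarrow> (v, w) \<in> gen_cong R (free_semimod R {..<n}) E))"

definition hom_lifting ::
    "('r, 'z) ring_scheme \<Rightarrow> ('r, 'a) module \<Rightarrow> ('r, 'b) module \<Rightarrow> ('r, 'c) module \<Rightarrow> ('b \<Rightarrow> 'c) \<Rightarrow> bool"
  where "hom_lifting R P M N g \<longleftrightarrow>
    (\<forall>h\<in>lin_hom R P N. \<exists>h'\<in>lin_hom R P M. \<forall>x\<in>carrier P. g (h' x) = h x)"

text \<open>
  Projectivity: \<open>Hom(P, g)\<close> is surjective for every surjective linear \<open>g\<close>.  As a definition in HOL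
  cannot quantify over types, \<open>M\<close> and \<open>N\<close> range over the semimodules on two fixed types, which
  are large enough to contain the free semimodule on \<open>carrier P\<close> and \<open>P\<close> itself.  Lemma
  \<open>projective_hom_lifting\<close> below shows that the property then holds for semimodules on all types.
\<close>

definition projective :: "('r, 'z) ring_scheme \<Rightarrow> ('r, 'a) module \<Rightarrow> bool"
  where "projective R P \<longleftrightarrow> right_semimodule R P \<and>
    (\<forall>(M :: ('r, 'a \<Rightarrow> 'r) module) (N :: ('r, 'a) module) g.
      right_semimodule R M \<and> right_semimodule R N \<and>
      g \<in> lin_hom R M N \<and> g ` carrier M = carrier N
      \<longrightarrow> hom_lifting R P M N g)"

lemma free_semimod_right_semimodule:
  assumes "semiring R"
  shows "right_semimodule R (free_semimod R X)"
proof -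
  interpret semiring R by fact
  let ?F = "free_semimod R X"
  have inR: "v x \<in> carrier R" if "v \<in> carrier ?F" for v x
    using that by (cases "x \<in> X") (auto simp: free_semimod_def)
  have fin: "finite {x. v x \<noteq> \<zero>\<^bsub>R\<^esub>}" if "v \<in> carrier ?F" for v
    using that by (auto simp: free_semimod_def)
  have add: "v \<oplus>\<^bsub>?F\<^esub> w \<in> carrier ?F" if v: "v \<in> carrier ?F" and w: "w \<in> carrier ?F" for v w
  proof -
    have "{x. v x \<oplus>\<^bsub>R\<^esub> w x \<noteq> \<zero>\<^bsub>R\<^esub>} \<subseteq> {x. v x \<noteq> \<zero>\<^bsub>R\<^esub>} \<union> {x. w x \<noteq> \<zero>\<^bsub>R\<^esub>}" by auto
    then have "finite {x. v x \<oplus>\<^bsub>R\<^esub> w x \<noteq> \<zero>\<^bsub>R\<^esub>}"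
      using fin[OF v] fin[OF w] by (meson finite_UnI finite_subset)
    then show ?thesis using v w by (auto simp: free_semimod_def)
  qed
  have smult: "a \<odot>\<^bsub>?F\<^esub> v \<in> carrier ?F" if a: "a \<in> carrier R" and v: "v \<in> carrier ?F" for a v
  proof -
    have "{x. v x \<otimes>\<^bsub>R\<^esub> a \<noteq> \<zero>\<^bsub>R\<^esub>} \<subseteq> {x. v x \<noteq> \<zero>\<^bsub>R\<^esub>}" using a by auto
    then have "finite {x. v x \<otimes>\<^bsub>R\<^esub> a \<noteq> \<zero>\<^bsub>R\<^esub>}"
      using fin[OF v] by (meson finite_subset)
    then show ?thesis using v a by (auto simp: free_semimod_def)
  qed
  have ab: "abelian_monoid ?F"
  proof (rule abelian_monoidI)
    show "\<zero>\<^bsub>?F\<^esub> \<in> carrier ?F" by (auto simp: free_semimod_def)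
    fix u v w assume *: "u \<in> carrier ?F" "v \<in> carrier ?F" "w \<in> carrier ?F"
    show "(u \<oplus>\<^bsub>?F\<^esub> v) \<oplus>\<^bsub>?F\<^esub> w = u \<oplus>\<^bsub>?F\<^esub> (v \<oplus>\<^bsub>?F\<^esub> w)"
      using inR[OF *(1)] inR[OF *(2)] inR[OF *(3)]
      by (simp add: free_semimod_def fun_eq_iff a_assoc)
  next
    fix v assume *: "v \<in> carrier ?F"
    show "\<zero>\<^bsub>?F\<^esub> \<oplus>\<^bsub>?F\<^esub> v = v"
      using inR[OF *] by (simp add: free_semimod_def fun_eq_iff)
  next
    fix v w assume *: "v \<in> carrier ?F" "w \<in> carrier ?F"
    show "v \<oplus>\<^bsub>?F\<^esub> w = w \<oplus>\<^bsub>?F\<^esub> v"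
      using inR[OF *(1)] inR[OF *(2)] by (simp add: free_semimod_def fun_eq_iff a_comm)
  qed (rule add)
  show ?thesis
  proof (intro right_semimodule.intro presemimodule.intro presemimodule_axioms.intro
      right_semimodule_axioms.intro ab assms smult)
    fix a b v w
    assume *: "v \<in> carrier ?F" and **: "w \<in> carrier ?F" and a: "a \<in> carrier R"
      and b: "b \<in> carrier R"
    show "a \<odot>\<^bsub>?F\<^esub> (v \<oplus>\<^bsub>?F\<^esub> w) = a \<odot>\<^bsub>?F\<^esub> v \<oplus>\<^bsub>?F\<^esub> a \<odot>\<^bsub>?F\<^esub> w"
      using inR[OF *] inR[OF **] a by (simp add: free_semimod_def fun_eq_iff l_distr)
  next
    fix a b v
    assume *: "v \<in> carrier ?F" and a: "a \<in> carrier R" and b: "b \<in> carrier R"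
    show "(a \<oplus>\<^bsub>R\<^esub> b) \<odot>\<^bsub>?F\<^esub> v = a \<odot>\<^bsub>?F\<^esub> v \<oplus>\<^bsub>?F\<^esub> b \<odot>\<^bsub>?F\<^esub> v"
      using inR[OF *] a b by (simp add: free_semimod_def fun_eq_iff r_distr)
    show "b \<odot>\<^bsub>?F\<^esub> (a \<odot>\<^bsub>?F\<^esub> v) = (a \<otimes>\<^bsub>R\<^esub> b) \<odot>\<^bsub>?F\<^esub> v"
      using inR[OF *] a b by (simp add: free_semimod_def fun_eq_iff m_assoc)
  next
    fix v assume *: "v \<in> carrier ?F"
    show "\<one>\<^bsub>R\<^esub> \<odot>\<^bsub>?F\<^esub> v = v"
      using inR[OF *] by (simp add: free_semimod_def fun_eq_iff)
    show "\<zero>\<^bsub>R\<^esub> \<odot>\<^bsub>?F\<^esub> v = \<zero>\<^bsub>?F\<^esub>"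
      using inR[OF *] by (simp add: free_semimod_def fun_eq_iff)
  next
    fix a assume "a \<in> carrier R"
    then show "a \<odot>\<^bsub>?F\<^esub> \<zero>\<^bsub>?F\<^esub> = \<zero>\<^bsub>?F\<^esub>"
      by (simp add: free_semimod_def fun_eq_iff)
  qed
qed

definition free_ext ::
    "('r, 'z) ring_scheme \<Rightarrow> ('r, 'a) module \<Rightarrow> ('x \<Rightarrow> 'a) \<Rightarrow> ('x \<Rightarrow> 'r) \<Rightarrow> 'a"
  where "free_ext R M \<phi> v = finsum M (\<lambda>x. v x \<odot>\<^bsub>M\<^esub> \<phi> x) {x. v x \<noteq> \<zero>\<^bsub>R\<^esub>}"

lemma free_semimodD:
  assumes "v \<in> carrier (free_semimod R X)"
  shows "finite {x. v x \<noteq> \<zero>\<^bsub>R\<^esub>}" "{x. v x \<noteq> \<zero>\<^bsub>R\<^esub>} \<subseteq> X" "x \<in> X \<Longrightarrow> v x \<in> carrier R"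
  using assms by (auto simp: free_semimod_def)

lemma free_ext_lin_hom:
  fixes M :: "('r, 'a) module" and \<phi> :: "'x \<Rightarrow> 'a"
  assumes "right_semimodule R M" and \<phi>: "\<phi> \<in> X \<rightarrow> carrier M"
  shows "free_ext R M \<phi> \<in> lin_hom R (free_semimod R X) M"
proof -
  interpret M: right_semimodule R M by fact
  let ?F = "free_semimod R X"
  interpret F: right_semimodule R ?F
    by (rule free_semimod_right_semimodule) (rule M.semiring_axioms)
  have larger: "free_ext R M \<phi> v = finsum M (\<lambda>x. v x \<odot>\<^bsub>M\<^esub> \<phi> x) A"
    if v: "v \<in> carrier ?F" and A: "finite A" "A \<subseteq> X" "{x. v x \<noteq> \<zero>\<^bsub>R\<^esub>} \<subseteq> A" for v A
    unfolding free_ext_def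
    by (rule M.add.finprod_mono_neutral_cong_left)
      (use A \<phi> free_semimodD[OF v] in \<open>auto simp: Pi_iff subset_iff\<close>)
  show ?thesis
  proof (rule lin_homI)
    fix v assume v: "v \<in> carrier ?F"
    show "free_ext R M \<phi> v \<in> carrier M"
      unfolding free_ext_def
      by (rule M.finsum_closed) (use \<phi> free_semimodD[OF v] in \<open>auto simp: Pi_iff subset_iff\<close>)
  next
    fix v w assume v: "v \<in> carrier ?F" and w: "w \<in> carrier ?F"
    let ?A = "{x. v x \<noteq> \<zero>\<^bsub>R\<^esub>} \<union> {x. w x \<noteq> \<zero>\<^bsub>R\<^esub>}"
    have A: "finite ?A" "?A \<subseteq> X"
      using free_semimodD[OF v] free_semimodD[OF w] by auto
    have vw: "v \<oplus>\<^bsub>?F\<^esub> w = (\<lambda>x. v x \<oplus>\<^bsub>R\<^esub> w x)" by (simp add: free_semimod_def)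
    have "{x. (v \<oplus>\<^bsub>?F\<^esub> w) x \<noteq> \<zero>\<^bsub>R\<^esub>} \<subseteq> ?A" by (auto simp: vw)
    then have "free_ext R M \<phi> (v \<oplus>\<^bsub>?F\<^esub> w) = finsum M (\<lambda>x. (v \<oplus>\<^bsub>?F\<^esub> w) x \<odot>\<^bsub>M\<^esub> \<phi> x) ?A"
      by (intro larger A) (use v w in auto)
    also have "\<dots> = finsum M (\<lambda>x. v x \<odot>\<^bsub>M\<^esub> \<phi> x \<oplus>\<^bsub>M\<^esub> w x \<odot>\<^bsub>M\<^esub> \<phi> x) ?A"
      by (rule M.finsum_cong')
        (use A \<phi> free_semimodD(3)[OF v] free_semimodD(3)[OF w] in
          \<open>auto simp: vw M.smult_l_distr Pi_iff subset_iff\<close>)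
    also have "\<dots> = finsum M (\<lambda>x. v x \<odot>\<^bsub>M\<^esub> \<phi> x) ?A \<oplus>\<^bsub>M\<^esub> finsum M (\<lambda>x. w x \<odot>\<^bsub>M\<^esub> \<phi> x) ?A"
      by (rule M.finsum_addf)
        (use A \<phi> free_semimodD(3)[OF v] free_semimodD(3)[OF w] in \<open>auto simp: Pi_iff subset_iff\<close>)
    also have "\<dots> = free_ext R M \<phi> v \<oplus>\<^bsub>M\<^esub> free_ext R M \<phi> w"
      using larger[OF v A] larger[OF w A] by simp
    finally show "free_ext R M \<phi> (v \<oplus>\<^bsub>?F\<^esub> w) = free_ext R M \<phi> v \<oplus>\<^bsub>M\<^esub> free_ext R M \<phi> w" .
  next
    fix a v assume a: "a \<in> carrier R" and v: "v \<in> carrier ?F"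
    let ?A = "{x. v x \<noteq> \<zero>\<^bsub>R\<^esub>}"
    have A: "finite ?A" "?A \<subseteq> X"
      using free_semimodD[OF v] by auto
    have av: "a \<odot>\<^bsub>?F\<^esub> v = (\<lambda>x. v x \<otimes>\<^bsub>R\<^esub> a)" by (simp add: free_semimod_def)
    have sum: "finsum M (\<lambda>x. a \<odot>\<^bsub>M\<^esub> h x) B = a \<odot>\<^bsub>M\<^esub> finsum M h B"
      if "finite B" "h \<in> B \<rightarrow> carrier M" for h :: "'x \<Rightarrow> 'a" and B
      using that
    proof (induction B)
      case (insert x B)
      then have "finsum M (\<lambda>x. a \<odot>\<^bsub>M\<^esub> h x) (insert x B)
        = a \<odot>\<^bsub>M\<^esub> h x \<oplus>\<^bsub>M\<^esub> finsum M (\<lambda>x. a \<odot>\<^bsub>M\<^esub> h x) B"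
        using a by (intro M.finsum_insert) auto
      then show ?case
        using insert a by (simp add: Pi_iff M.smult_r_distr)
    qed (simp add: a)
    have "{x. (a \<odot>\<^bsub>?F\<^esub> v) x \<noteq> \<zero>\<^bsub>R\<^esub>} \<subseteq> ?A" using a by (auto simp: av)
    then have "free_ext R M \<phi> (a \<odot>\<^bsub>?F\<^esub> v) = finsum M (\<lambda>x. (a \<odot>\<^bsub>?F\<^esub> v) x \<odot>\<^bsub>M\<^esub> \<phi> x) ?A"
      by (intro larger A) (use a v in auto)
    also have "\<dots> = finsum M (\<lambda>x. a \<odot>\<^bsub>M\<^esub> (v x \<odot>\<^bsub>M\<^esub> \<phi> x)) ?A"
      by (rule M.finsum_cong')
        (use A a \<phi> free_semimodD(3)[OF v] in \<open>auto simp: av M.right_assoc Pi_iff subset_iff\<close>)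
    also have "\<dots> = a \<odot>\<^bsub>M\<^esub> finsum M (\<lambda>x. v x \<odot>\<^bsub>M\<^esub> \<phi> x) ?A"
      by (rule sum) (use A \<phi> free_semimodD(3)[OF v] in \<open>auto simp: Pi_iff subset_iff\<close>)
    finally show "free_ext R M \<phi> (a \<odot>\<^bsub>?F\<^esub> v) = a \<odot>\<^bsub>M\<^esub> free_ext R M \<phi> v"
      by (simp add: free_ext_def)
  qed
qed

lemma lin_hom_free_ext:
  fixes M :: "('r, 'a) module" and \<phi> :: "'x \<Rightarrow> 'a"
  assumes "right_semimodule R M" "right_semimodule R N" and f: "f \<in> lin_hom R M N"
    and \<phi>: "\<phi> \<in> X \<rightarrow> carrier M" and v: "v \<in> carrier (free_semimod R X)"
  shows "f (free_ext R M \<phi> v) = free_ext R N (\<lambda>x. f (\<phi> x)) v"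
proof -
  interpret M: right_semimodule R M by fact
  interpret N: right_semimodule R N by fact
  have f0: "f \<zero>\<^bsub>M\<^esub> = \<zero>\<^bsub>N\<^esub>"
    using lin_hom_zero[OF f] M.presemimodule_axioms N.presemimodule_axioms by blast
  have sum: "f (finsum M h B) = finsum N (\<lambda>x. f (h x)) B"
    if "finite B" "h \<in> B \<rightarrow> carrier M" for h :: "'x \<Rightarrow> 'a" and B
    using that
  proof (induction B)
    case (insert x B)
    then have "finsum N (\<lambda>x. f (h x)) (insert x B) = f (h x) \<oplus>\<^bsub>N\<^esub> finsum N (\<lambda>x. f (h x)) B"
      using lin_homD(1)[OF f] by (intro N.finsum_insert) auto
    then show ?case
      using insert by (simp add: Pi_iff lin_homD[OF f])
  qed (simp add: f0)
  have "f (free_ext R M \<phi> v) = finsum N (\<lambda>x. f (v x \<odot>\<^bsub>M\<^esub> \<phi> x)) {x. v x \<noteq> \<zero>\<^bsub>R\<^esub>}"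
    unfolding free_ext_def
    by (rule sum) (use \<phi> free_semimodD[OF v] in \<open>auto simp: Pi_iff subset_iff\<close>)
  also have "\<dots> = free_ext R N (\<lambda>x. f (\<phi> x)) v"
    unfolding free_ext_def
    by (rule N.finsum_cong')
      (use \<phi> free_semimodD[OF v] in \<open>auto simp: Pi_iff subset_iff lin_homD[OF f]\<close>)
  finally show ?thesis .
qed

lemma free_ext_cong:
  assumes "right_semimodule R M" "\<And>x. x \<in> X \<Longrightarrow> \<phi> x = \<psi> x" "\<phi> \<in> X \<rightarrow> carrier M"
    and v: "v \<in> carrier (free_semimod R X)"
  shows "free_ext R M \<phi> v = free_ext R M \<psi> v"
proof -
  interpret M: right_semimodule R M by fact
  show ?thesis
    unfolding free_ext_def
    by (rule M.finsum_cong')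
      (use assms(2,3) free_semimodD[OF v] in \<open>auto simp: Pi_iff subset_iff\<close>)
qed

lemma projective_hom_lifting:
  fixes P :: "('r, 'a) module" and M :: "('r, 'b) module" and N :: "('r, 'c) module"
  assumes P: "projective R P" and M: "right_semimodule R M" and N: "right_semimodule R N"
    and g: "g \<in> lin_hom R M N" "g ` carrier M = carrier N"
  shows "hom_lifting R P M N g"
  unfolding hom_lifting_def
proof
  fix h assume h: "h \<in> lin_hom R P N"
  have rP: "right_semimodule R P" using P by (simp add: projective_def)
  interpret P: right_semimodule R P by fact
  let ?F = "free_semimod R (carrier P)"
  have F: "right_semimodule R ?F"
    by (rule free_semimod_right_semimodule) (rule P.semiring_axioms)
  let ?e = "free_ext R P (\<lambda>x. x)"
  have e: "?e \<in> lin_hom R ?F P"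
    by (rule free_ext_lin_hom[OF rP]) auto
  have "x \<in> ?e ` carrier ?F" if x: "x \<in> carrier P" for x
  proof -
    define d where "d = (\<lambda>y. if y = x then \<one>\<^bsub>R\<^esub> else \<zero>\<^bsub>R\<^esub>)"
    have d: "d \<in> carrier ?F" using x by (auto simp: d_def free_semimod_def)
    have trivial: "x = \<zero>\<^bsub>P\<^esub>" if "\<one>\<^bsub>R\<^esub> = \<zero>\<^bsub>R\<^esub>"
      using that P.smult_one[OF x] P.smult_l_null[OF x] by simp
    have "?e d = finsum P (\<lambda>y. d y \<odot>\<^bsub>P\<^esub> y) {x}"
      unfolding free_ext_def
      by (rule P.add.finprod_mono_neutral_cong_left)
        (use x trivial in \<open>auto simp: d_def split: if_splits\<close>)
    also have "\<dots> = x"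
      using x by (simp add: d_def)
    finally show ?thesis using d by (metis imageI)
  qed
  then have "?e ` carrier ?F = carrier P"
    using lin_homD(1)[OF e] by auto
  then have "hom_lifting R P ?F P ?e"
    using P F rP e unfolding projective_def by blast
  moreover have "(\<lambda>x. x) \<in> lin_hom R P P" by (rule lin_homI) auto
  ultimately obtain s where s: "s \<in> lin_hom R P ?F" "\<And>x. x \<in> carrier P \<Longrightarrow> ?e (s x) = x"
    unfolding hom_lifting_def by fastforce
  have "\<exists>m\<in>carrier M. g m = h x" if "x \<in> carrier P" for x
  proof -
    have "h x \<in> g ` carrier M" using g(2) lin_homD(1)[OF h that] by simp
    then show ?thesis by auto
  qed
  then obtain m where m: "\<And>x. x \<in> carrier P \<Longrightarrow> m x \<in> carrier M \<and> g (m x) = h x"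
    by metis
  have mM: "m \<in> carrier P \<rightarrow> carrier M" using m by auto
  show "\<exists>h'\<in>lin_hom R P M. \<forall>x\<in>carrier P. g (h' x) = h x"
  proof (intro bexI ballI)
    show "(\<lambda>x. free_ext R M m (s x)) \<in> lin_hom R P M"
      by (rule lin_hom_comp[OF s(1) free_ext_lin_hom[OF M mM]])
    fix x assume x: "x \<in> carrier P"
    have sx: "s x \<in> carrier ?F" using s(1) x by (rule lin_homD)
    have "g (free_ext R M m (s x)) = free_ext R N (\<lambda>y. g (m y)) (s x)"
      by (rule lin_hom_free_ext[OF M N g(1) mM sx])
    also have "\<dots> = free_ext R N h (s x)"
      by (rule free_ext_cong[OF N _ _ sx]) (use m lin_homD(1)[OF h] in auto)
    also have "\<dots> = h (?e (s x))"
      by (rule lin_hom_free_ext[OF rP N h _ sx, symmetric]) auto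
    finally show "g (free_ext R M m (s x)) = h x" using s(2) x by simp
  qed
qed


section \<open>Directed limits and flatness\<close>

definition directed_set :: "'i set \<Rightarrow> ('i \<times> 'i) set \<Rightarrow> bool"
  where "directed_set I r \<longleftrightarrow> I \<noteq> {} \<and> preorder_on I r \<and>
    (\<forall>i\<in>I. \<forall>j\<in>I. \<exists>k\<in>I. (i, k) \<in> r \<and> (j, k) \<in> r)"

locale directed_system = semiring R for R (structure) +
  fixes I :: "'i set" and r :: "('i \<times> 'i) set"
    and M :: "'i \<Rightarrow> ('a, 'c) module" and \<phi> :: "'i \<Rightarrow> 'i \<Rightarrow> 'c \<Rightarrow> 'c"
  assumes directed: "directed_set I r"
    and semimod: "i \<in> I \<Longrightarrow> right_semimodule R (M i)"
    and trans_lin: "(i, j) \<in> r \<Longrightarrow> \<phi> i j \<in> lin_hom R (M i) (M j)"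
    and trans_id: "\<lbrakk>i \<in> I; x \<in> carrier (M i)\<rbrakk> \<Longrightarrow> \<phi> i i x = x"
    and trans_comp: "\<lbrakk>(i, j) \<in> r; (j, k) \<in> r; x \<in> carrier (M i)\<rbrakk> \<Longrightarrow> \<phi> j k (\<phi> i j x) = \<phi> i k x"

text \<open>
  The directed limit is the usual quotient of the disjoint union of the \<open>M i\<close>; its universal
  property is proved below (\<open>dirlim_universal\<close>).
\<close>

definition dirlim_cong ::
    "'i set \<Rightarrow> ('i \<times> 'i) set \<Rightarrow> ('i \<Rightarrow> ('r, 'c) module) \<Rightarrow> ('i \<Rightarrow> 'i \<Rightarrow> 'c \<Rightarrow> 'c) \<Rightarrow>
     (('i \<times> 'c) \<times> ('i \<times> 'c)) set"
  where "dirlim_cong I r M \<phi> =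
    {((i, x), (j, y)) | i x j y. i \<in> I \<and> j \<in> I \<and> x \<in> carrier (M i) \<and> y \<in> carrier (M j) \<and>
      (\<exists>k\<in>I. (i, k) \<in> r \<and> (j, k) \<in> r \<and> \<phi> i k x = \<phi> j k y)}"

definition dirlim ::
    "'i set \<Rightarrow> ('i \<times> 'i) set \<Rightarrow> ('i \<Rightarrow> ('r, 'c) module) \<Rightarrow> ('i \<Rightarrow> 'i \<Rightarrow> 'c \<Rightarrow> 'c) \<Rightarrow>
     ('r, ('i \<times> 'c) set) module"
  where "dirlim I r M \<phi> =
    \<lparr>carrier = (SIGMA i:I. carrier (M i)) // dirlim_cong I r M \<phi>,
     monoid.mult = undefined, one = undefined,
     zero = dirlim_cong I r M \<phi> `` {(i, \<zero>\<^bsub>M i\<^esub>) | i. i \<in> I},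
     add = (\<lambda>A B. dirlim_cong I r M \<phi> ``
              {(k, \<phi> i k x \<oplus>\<^bsub>M k\<^esub> \<phi> j k y) | i x j y k.
                 (i, x) \<in> A \<and> (j, y) \<in> B \<and> k \<in> I \<and> (i, k) \<in> r \<and> (j, k) \<in> r}),
     smult = (\<lambda>a A. dirlim_cong I r M \<phi> `` {(i, a \<odot>\<^bsub>M i\<^esub> x) | i x. (i, x) \<in> A})\<rparr>"

definition dirlim_inj ::
    "'i set \<Rightarrow> ('i \<times> 'i) set \<Rightarrow> ('i \<Rightarrow> ('r, 'c) module) \<Rightarrow> ('i \<Rightarrow> 'i \<Rightarrow> 'c \<Rightarrow> 'c) \<Rightarrow>
     'i \<Rightarrow> 'c \<Rightarrow> ('i \<times> 'c) set"
  where "dirlim_inj I r M \<phi> i x = dirlim_cong I r M \<phi> `` {(i, x)}"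

lemma Image_eq_class:
  assumes "equiv A s" "S \<noteq> {}" "\<And>y. y \<in> S \<Longrightarrow> (y, x) \<in> s"
  shows "s `` S = s `` {x}"
proof -
  have "s `` {y} = s `` {x}" if "y \<in> S" for y
    using equiv_class_eq[OF assms(1) assms(3)[OF that]] .
  then show ?thesis using assms(2) by (auto simp: Image_iff)
qed

context directed_system
begin

lemma index_mem: "(i, j) \<in> r \<Longrightarrow> i \<in> I" "(i, j) \<in> r \<Longrightarrow> j \<in> I"
  using directed by (auto simp: directed_set_def preorder_on_def)

lemma index_trans: "\<lbrakk>(i, j) \<in> r; (j, k) \<in> r\<rbrakk> \<Longrightarrow> (i, k) \<in> r"
  using directed by (meson directed_set_def preorder_on_def transD)

lemma index_refl: "i \<in> I \<Longrightarrow> (i, i) \<in> r"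
  using directed by (auto simp: directed_set_def preorder_on_def refl_on_def)

lemma index_ub:
  assumes "i \<in> I" "j \<in> I"
  obtains k where "k \<in> I" "(i, k) \<in> r" "(j, k) \<in> r"
  using directed assms by (auto simp: directed_set_def)

lemmas trans_homD = lin_homD[OF trans_lin]

lemma trans_zero: "(i, j) \<in> r \<Longrightarrow> \<phi> i j \<zero>\<^bsub>M i\<^esub> = \<zero>\<^bsub>M j\<^esub>"
  using lin_hom_zero[OF trans_lin] semimod index_mem
  by (metis right_semimodule.axioms(1))

lemma dirlim_congE:
  assumes "((i, x), (j, y)) \<in> dirlim_cong I r M \<phi>"
  obtains l where "i \<in> I" "j \<in> I" "x \<in> carrier (M i)" "y \<in> carrier (M j)"
    "(i, l) \<in> r" "(j, l) \<in> r" "\<forall>u. (l, u) \<in> r \<longrightarrow> \<phi> i u x = \<phi> j u y"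
proof -
  from assms obtain l where l: "i \<in> I" "j \<in> I" "x \<in> carrier (M i)" "y \<in> carrier (M j)"
    "(i, l) \<in> r" "(j, l) \<in> r" "\<phi> i l x = \<phi> j l y"
    by (auto simp: dirlim_cong_def)
  then have "\<forall>u. (l, u) \<in> r \<longrightarrow> \<phi> i u x = \<phi> j u y"
    using trans_comp by metis
  with l that show thesis by blast
qed

lemma dirlim_congI:
  assumes "x \<in> carrier (M i)" "y \<in> carrier (M j)" "(i, k) \<in> r" "(j, k) \<in> r" "\<phi> i k x = \<phi> j k y"
  shows "((i, x), (j, y)) \<in> dirlim_cong I r M \<phi>"
  using assms index_mem unfolding dirlim_cong_def by blast

lemma dirlim_equiv: "equiv (SIGMA i:I. carrier (M i)) (dirlim_cong I r M \<phi>)"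
proof (rule equivI)
  show "dirlim_cong I r M \<phi> \<subseteq> (SIGMA i:I. carrier (M i)) \<times> (SIGMA i:I. carrier (M i))"
    by (auto simp: dirlim_cong_def)
  show "refl_on (SIGMA i:I. carrier (M i)) (dirlim_cong I r M \<phi>)"
    using index_refl by (auto simp: refl_on_def dirlim_cong_def)
  show "sym (dirlim_cong I r M \<phi>)"
    by (auto simp: sym_def dirlim_cong_def)
  show "trans (dirlim_cong I r M \<phi>)"
  proof (rule transI)
    fix p q s
    assume 1: "(p, q) \<in> dirlim_cong I r M \<phi>" and 2: "(q, s) \<in> dirlim_cong I r M \<phi>"
    obtain i x where p: "p = (i, x)" by force
    obtain j y where q: "q = (j, y)" by force
    obtain k z where s: "s = (k, z)" by force
    from 1[unfolded p q] obtain l where l: "i \<in> I" "j \<in> I" "x \<in> carrier (M i)" "y \<in> carrier (M j)"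
      "(i, l) \<in> r" "(j, l) \<in> r"
      "\<forall>u. (l, u) \<in> r \<longrightarrow> \<phi> i u x = \<phi> j u y" by (rule dirlim_congE)
    from 2[unfolded q s] obtain m where m: "j \<in> I" "k \<in> I" "y \<in> carrier (M j)" "z \<in> carrier (M k)"
      "(j, m) \<in> r" "(k, m) \<in> r"
      "\<forall>u. (m, u) \<in> r \<longrightarrow> \<phi> j u y = \<phi> k u z" by (rule dirlim_congE)
    obtain u where u: "(l, u) \<in> r" "(m, u) \<in> r" using index_ub index_mem l(5) m(5) by metis
    have "(i, u) \<in> r" "(k, u) \<in> r"
      using index_trans[OF l(5) u(1)] index_trans[OF m(6) u(2)] by auto
    moreover have "\<phi> i u x = \<phi> k u z"
      using l(7)[rule_format, OF u(1)] m(7)[rule_format, OF u(2)] by simp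
    ultimately show "(p, s) \<in> dirlim_cong I r M \<phi>"
      unfolding p s by (intro dirlim_congI[OF l(3) m(4)])
  qed
qed

lemma dirlim_inj_eq_iff:
  assumes "i \<in> I" "j \<in> I" "x \<in> carrier (M i)" "y \<in> carrier (M j)"
  shows "dirlim_inj I r M \<phi> i x = dirlim_inj I r M \<phi> j y \<longleftrightarrow>
    (\<exists>k\<in>I. (i, k) \<in> r \<and> (j, k) \<in> r \<and> \<phi> i k x = \<phi> j k y)"
proof -
  have "dirlim_inj I r M \<phi> i x = dirlim_inj I r M \<phi> j y \<longleftrightarrow>
      ((i, x), (j, y)) \<in> dirlim_cong I r M \<phi>"
    unfolding dirlim_inj_def
    by (rule eq_equiv_class_iff[OF dirlim_equiv]) (use assms in auto)
  then show ?thesis using assms by (auto simp: dirlim_cong_def)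
qed

lemma dirlim_inj_trans:
  assumes "(i, j) \<in> r" "x \<in> carrier (M i)"
  shows "dirlim_inj I r M \<phi> j (\<phi> i j x) = dirlim_inj I r M \<phi> i x"
  using assms index_mem[OF assms(1)] index_refl trans_homD(1)[OF assms] trans_id
  by (subst dirlim_inj_eq_iff) (auto intro!: bexI[of _ j])

lemma dirlim_carrier:
  "carrier (dirlim I r M \<phi>) = {dirlim_inj I r M \<phi> i x | i x. i \<in> I \<and> x \<in> carrier (M i)}"
  by (auto simp: dirlim_def dirlim_inj_def quotient_def)

lemma dirlim_inj_closed:
  "\<lbrakk>i \<in> I; x \<in> carrier (M i)\<rbrakk> \<Longrightarrow> dirlim_inj I r M \<phi> i x \<in> carrier (dirlim I r M \<phi>)"
  by (auto simp: dirlim_carrier)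

lemma dirlim_common:
  assumes "i \<in> I" "A \<in> carrier (dirlim I r M \<phi>)"
  obtains k x where "(i, k) \<in> r" "x \<in> carrier (M k)" "A = dirlim_inj I r M \<phi> k x"
proof -
  from assms(2) obtain j y where j: "j \<in> I" "y \<in> carrier (M j)" "A = dirlim_inj I r M \<phi> j y"
    by (auto simp: dirlim_carrier)
  obtain k where k: "(i, k) \<in> r" "(j, k) \<in> r" using index_ub assms(1) j(1) by metis
  show thesis
    using that[OF k(1) trans_homD(1)[OF k(2) j(2)]] dirlim_inj_trans[OF k(2) j(2)] j(3) by simp
qed

lemma dirlim_zero:
  assumes "i \<in> I"
  shows "\<zero>\<^bsub>dirlim I r M \<phi>\<^esub> = dirlim_inj I r M \<phi> i \<zero>\<^bsub>M i\<^esub>"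
proof -
  have Z: "\<zero>\<^bsub>M i\<^esub> \<in> carrier (M i)" if "i \<in> I" for i
    using semimod[OF that] by (meson abelian_monoid.zero_closed presemimodule_def right_semimodule_def)
  have "((j, \<zero>\<^bsub>M j\<^esub>), (i, \<zero>\<^bsub>M i\<^esub>)) \<in> dirlim_cong I r M \<phi>" if j: "j \<in> I" for j
  proof -
    obtain k where "(i, k) \<in> r" "(j, k) \<in> r" using index_ub assms(1) j by metis
    then show ?thesis using Z j assms trans_zero by (intro dirlim_congI[where k = k]) auto
  qed
  then have "dirlim_cong I r M \<phi> `` {(i, \<zero>\<^bsub>M i\<^esub>) | i. i \<in> I} = dirlim_cong I r M \<phi> `` {(i, \<zero>\<^bsub>M i\<^esub>)}"
    using assms by (intro Image_eq_class[OF dirlim_equiv]) auto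
  then show ?thesis by (simp add: dirlim_def dirlim_inj_def)
qed

lemma dirlim_add:
  assumes i: "i \<in> I" and x: "x \<in> carrier (M i)" and y: "y \<in> carrier (M i)"
  shows "dirlim_inj I r M \<phi> i x \<oplus>\<^bsub>dirlim I r M \<phi>\<^esub> dirlim_inj I r M \<phi> i y
    = dirlim_inj I r M \<phi> i (x \<oplus>\<^bsub>M i\<^esub> y)"
proof -
  let ?S = "{(k, \<phi> i' k x' \<oplus>\<^bsub>M k\<^esub> \<phi> j' k y') | i' x' j' y' k.
      (i', x') \<in> dirlim_inj I r M \<phi> i x \<and> (j', y') \<in> dirlim_inj I r M \<phi> i y \<and>
      k \<in> I \<and> (i', k) \<in> r \<and> (j', k) \<in> r}"
  have abm: "abelian_monoid (M j)" if "j \<in> I" for j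
    using semimod[OF that] by (simp add: presemimodule_def right_semimodule_def)
  have "(i, x) \<in> dirlim_inj I r M \<phi> i x" "(i, y) \<in> dirlim_inj I r M \<phi> i y"
    using equiv_class_self[OF dirlim_equiv] i x y by (auto simp: dirlim_inj_def)
  then have ne: "?S \<noteq> {}" using index_refl[OF i] i by blast
  have rel: "(p, (i, x \<oplus>\<^bsub>M i\<^esub> y)) \<in> dirlim_cong I r M \<phi>" if "p \<in> ?S" for p
  proof -
    from that obtain i' x' j' y' k where p: "p = (k, \<phi> i' k x' \<oplus>\<^bsub>M k\<^esub> \<phi> j' k y')"
      and 1: "((i, x), (i', x')) \<in> dirlim_cong I r M \<phi>"
      and 2: "((i, y), (j', y')) \<in> dirlim_cong I r M \<phi>"
      and k: "k \<in> I" "(i', k) \<in> r" "(j', k) \<in> r"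
      by (auto simp: dirlim_inj_def)
    from 1 obtain l where l: "i \<in> I" "i' \<in> I" "x \<in> carrier (M i)" "x' \<in> carrier (M i')"
      "(i, l) \<in> r" "(i', l) \<in> r"
      "\<forall>u. (l, u) \<in> r \<longrightarrow> \<phi> i u x = \<phi> i' u x'" by (rule dirlim_congE)
    from 2 obtain m where m: "i \<in> I" "j' \<in> I" "y \<in> carrier (M i)" "y' \<in> carrier (M j')"
      "(i, m) \<in> r" "(j', m) \<in> r"
      "\<forall>u. (m, u) \<in> r \<longrightarrow> \<phi> i u y = \<phi> j' u y'" by (rule dirlim_congE)
    obtain n where n: "n \<in> I" "(l, n) \<in> r" "(m, n) \<in> r"
      using index_ub index_mem l(5) m(5) by metis
    obtain u where u: "(n, u) \<in> r" "(k, u) \<in> r" using index_ub n(1) k(1) by metis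
    have lu: "(l, u) \<in> r" and mu: "(m, u) \<in> r" using n u index_trans by blast+
    have iu: "(i, u) \<in> r" using l(5) lu index_trans by blast
    have px: "\<phi> i' k x' \<in> carrier (M k)" and py: "\<phi> j' k y' \<in> carrier (M k)"
      using trans_homD(1) k l(4) m(4) by blast+
    have "\<phi> k u (\<phi> i' k x' \<oplus>\<^bsub>M k\<^esub> \<phi> j' k y') = \<phi> i' u x' \<oplus>\<^bsub>M u\<^esub> \<phi> j' u y'"
      using trans_homD(2)[OF u(2) px py] trans_comp k u l(4) m(4) by simp
    also have "\<dots> = \<phi> i u (x \<oplus>\<^bsub>M i\<^esub> y)"
      using trans_homD(2)[OF iu x y] l(7)[rule_format, OF lu] m(7)[rule_format, OF mu] by simp
    finally show ?thesis
      unfolding p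
      by (intro dirlim_congI[where k = u])
        (use px py x y u iu abm[OF k(1)] abm[OF i] in \<open>auto intro: abelian_monoid.a_closed\<close>)
  qed
  have "dirlim_cong I r M \<phi> `` ?S = dirlim_cong I r M \<phi> `` {(i, x \<oplus>\<^bsub>M i\<^esub> y)}"
    by (rule Image_eq_class[OF dirlim_equiv ne rel])
  then show ?thesis by (simp add: dirlim_def dirlim_inj_def)
qed

lemma dirlim_smult:
  assumes a: "a \<in> carrier R" and i: "i \<in> I" and x: "x \<in> carrier (M i)"
  shows "a \<odot>\<^bsub>dirlim I r M \<phi>\<^esub> dirlim_inj I r M \<phi> i x = dirlim_inj I r M \<phi> i (a \<odot>\<^bsub>M i\<^esub> x)"
proof -
  let ?S = "{(j, a \<odot>\<^bsub>M j\<^esub> y) | j y. (j, y) \<in> dirlim_inj I r M \<phi> i x}"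
  have sm: "a \<odot>\<^bsub>M j\<^esub> y \<in> carrier (M j)" if "j \<in> I" "y \<in> carrier (M j)" for j y
    using semimod[OF that(1)] that a
    by (meson presemimodule.smult_closed right_semimodule_def)
  have "(i, x) \<in> dirlim_inj I r M \<phi> i x"
    using equiv_class_self[OF dirlim_equiv] i x by (auto simp: dirlim_inj_def)
  then have ne: "?S \<noteq> {}" by blast
  have rel: "(p, (i, a \<odot>\<^bsub>M i\<^esub> x)) \<in> dirlim_cong I r M \<phi>" if "p \<in> ?S" for p
  proof -
    from that obtain j y where p: "p = (j, a \<odot>\<^bsub>M j\<^esub> y)"
      and 1: "((i, x), (j, y)) \<in> dirlim_cong I r M \<phi>"
      by (auto simp: dirlim_inj_def)
    from 1 obtain l where l: "i \<in> I" "j \<in> I" "x \<in> carrier (M i)" "y \<in> carrier (M j)"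
      "(i, l) \<in> r" "(j, l) \<in> r"
      "\<forall>u. (l, u) \<in> r \<longrightarrow> \<phi> i u x = \<phi> j u y" by (rule dirlim_congE)
    have "\<phi> i l x = \<phi> j l y"
      using l(7)[rule_format, OF index_refl[OF index_mem(2)[OF l(5)]]] .
    then have "\<phi> j l (a \<odot>\<^bsub>M j\<^esub> y) = \<phi> i l (a \<odot>\<^bsub>M i\<^esub> x)"
      using trans_homD(3)[OF l(6) a l(4)] trans_homD(3)[OF l(5) a x] by simp
    then show ?thesis
      unfolding p by (intro dirlim_congI[OF sm[OF l(2,4)] sm[OF i x] l(6,5)])
  qed
  have "dirlim_cong I r M \<phi> `` ?S = dirlim_cong I r M \<phi> `` {(i, a \<odot>\<^bsub>M i\<^esub> x)}"
    by (rule Image_eq_class[OF dirlim_equiv ne rel])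
  then show ?thesis by (simp add: dirlim_def dirlim_inj_def)
qed

lemma dirlim_inj_lin_hom:
  "i \<in> I \<Longrightarrow> dirlim_inj I r M \<phi> i \<in> lin_hom R (M i) (dirlim I r M \<phi>)"
  by (rule lin_homI) (simp_all add: dirlim_inj_closed dirlim_add dirlim_smult)

lemma dirlim_cases3:
  assumes "A \<in> carrier (dirlim I r M \<phi>)" "B \<in> carrier (dirlim I r M \<phi>)" "C \<in> carrier (dirlim I r M \<phi>)"
  obtains k x y z where "k \<in> I" "x \<in> carrier (M k)" "y \<in> carrier (M k)" "z \<in> carrier (M k)"
    "A = dirlim_inj I r M \<phi> k x" "B = dirlim_inj I r M \<phi> k y" "C = dirlim_inj I r M \<phi> k z"
proof -
  from assms(1) obtain i x where i: "i \<in> I" "x \<in> carrier (M i)" "A = dirlim_inj I r M \<phi> i x"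
    by (auto simp: dirlim_carrier)
  obtain j y where j: "(i, j) \<in> r" "y \<in> carrier (M j)" "B = dirlim_inj I r M \<phi> j y"
    using dirlim_common[OF i(1) assms(2)] .
  obtain k z where k: "(j, k) \<in> r" "z \<in> carrier (M k)" "C = dirlim_inj I r M \<phi> k z"
    using dirlim_common[OF index_mem(2)[OF j(1)] assms(3)] .
  have ik: "(i, k) \<in> r" using j(1) k(1) index_trans by blast
  show thesis
    using that[OF index_mem(2)[OF k(1)] trans_homD(1)[OF ik i(2)] trans_homD(1)[OF k(1) j(2)] k(2)]
      dirlim_inj_trans[OF ik i(2)] dirlim_inj_trans[OF k(1) j(2)] i(3) j(3) k(3) by simp
qed

lemma dirlim_right_semimodule: "right_semimodule R (dirlim I r M \<phi>)"
proof -
  let ?D = "dirlim I r M \<phi>"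
  obtain i0 where i0: "i0 \<in> I" using directed by (auto simp: directed_set_def)
  have rs: "right_semimodule R (M i)" "presemimodule R (M i)" "abelian_monoid (M i)" if "i \<in> I" for i
    using semimod[OF that] by (simp_all add: presemimodule_def right_semimodule_def)
  note ops = dirlim_add dirlim_smult dirlim_inj_closed
    abelian_monoid.a_closed[OF rs(3)] presemimodule.smult_closed[OF rs(2)]
    abelian_monoid.zero_closed[OF rs(3)]
  have ab: "abelian_monoid ?D"
  proof (rule abelian_monoidI)
    show "\<zero>\<^bsub>?D\<^esub> \<in> carrier ?D" using i0 by (simp add: dirlim_zero ops)
    fix A B C assume *: "A \<in> carrier ?D" "B \<in> carrier ?D" "C \<in> carrier ?D"
    then obtain k x y z where "k \<in> I" "x \<in> carrier (M k)" "y \<in> carrier (M k)" "z \<in> carrier (M k)"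
      "A = dirlim_inj I r M \<phi> k x" "B = dirlim_inj I r M \<phi> k y" "C = dirlim_inj I r M \<phi> k z"
      by (rule dirlim_cases3)
    then show "(A \<oplus>\<^bsub>?D\<^esub> B) \<oplus>\<^bsub>?D\<^esub> C = A \<oplus>\<^bsub>?D\<^esub> (B \<oplus>\<^bsub>?D\<^esub> C)"
      by (simp add: ops abelian_monoid.a_assoc[OF rs(3)])
  next
    fix A B assume *: "A \<in> carrier ?D" "B \<in> carrier ?D"
    from dirlim_cases3[OF this *(2)] obtain k x y
      where "k \<in> I" "x \<in> carrier (M k)" "y \<in> carrier (M k)"
      "A = dirlim_inj I r M \<phi> k x" "B = dirlim_inj I r M \<phi> k y" .
    then show "A \<oplus>\<^bsub>?D\<^esub> B \<in> carrier ?D" "A \<oplus>\<^bsub>?D\<^esub> B = B \<oplus>\<^bsub>?D\<^esub> A"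
      by (simp_all add: ops abelian_monoid.a_comm[OF rs(3)])
  next
    fix A assume "A \<in> carrier ?D"
    then obtain k x where "k \<in> I" "x \<in> carrier (M k)" "A = dirlim_inj I r M \<phi> k x"
      by (auto simp: dirlim_carrier)
    then show "\<zero>\<^bsub>?D\<^esub> \<oplus>\<^bsub>?D\<^esub> A = A"
      by (simp add: dirlim_zero[of k] ops abelian_monoid.l_zero[OF rs(3)])
  qed
  show ?thesis
  proof (intro right_semimodule.intro presemimodule.intro presemimodule_axioms.intro
      right_semimodule_axioms.intro ab semiring_axioms)
    fix a A B assume a: "a \<in> carrier R" and *: "A \<in> carrier ?D" "B \<in> carrier ?D"
    from dirlim_cases3[OF * *(2)] obtain k x y
      where "k \<in> I" "x \<in> carrier (M k)" "y \<in> carrier (M k)"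
      "A = dirlim_inj I r M \<phi> k x" "B = dirlim_inj I r M \<phi> k y" .
    then show "a \<odot>\<^bsub>?D\<^esub> (A \<oplus>\<^bsub>?D\<^esub> B) = a \<odot>\<^bsub>?D\<^esub> A \<oplus>\<^bsub>?D\<^esub> a \<odot>\<^bsub>?D\<^esub> B"
      using a by (simp add: ops presemimodule.smult_r_distr[OF rs(2)])
  next
    fix a assume "a \<in> carrier R"
    then show "a \<odot>\<^bsub>?D\<^esub> \<zero>\<^bsub>?D\<^esub> = \<zero>\<^bsub>?D\<^esub>"
      using i0 by (simp add: dirlim_zero[of i0] ops presemimodule.smult_r_null[OF rs(2)])
  next
    fix a b A assume a: "a \<in> carrier R" and b: "b \<in> carrier R" and "A \<in> carrier ?D"
    then obtain k x where "k \<in> I" "x \<in> carrier (M k)" "A = dirlim_inj I r M \<phi> k x"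
      by (auto simp: dirlim_carrier)
    then show "(a \<oplus> b) \<odot>\<^bsub>?D\<^esub> A = a \<odot>\<^bsub>?D\<^esub> A \<oplus>\<^bsub>?D\<^esub> b \<odot>\<^bsub>?D\<^esub> A"
      "b \<odot>\<^bsub>?D\<^esub> (a \<odot>\<^bsub>?D\<^esub> A) = (a \<otimes> b) \<odot>\<^bsub>?D\<^esub> A"
      using a b by (simp_all add: ops presemimodule.smult_l_distr[OF rs(2)]
          right_semimodule.right_assoc[OF rs(1)])
  next
    fix a A assume "A \<in> carrier ?D"
    then obtain k x where *: "k \<in> I" "x \<in> carrier (M k)" "A = dirlim_inj I r M \<phi> k x"
      by (auto simp: dirlim_carrier)
    then show "\<one> \<odot>\<^bsub>?D\<^esub> A = A" "\<zero> \<odot>\<^bsub>?D\<^esub> A = \<zero>\<^bsub>?D\<^esub>"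
      by (simp_all add: ops dirlim_zero[of k] presemimodule.smult_one[OF rs(2)]
          presemimodule.smult_l_null[OF rs(2)])
    show "a \<odot>\<^bsub>?D\<^esub> A \<in> carrier ?D" if "a \<in> carrier R"
      using * that by (simp add: ops)
  qed
qed

lemma dirlim_universal:
  fixes G :: "('a, 'g) module"
  assumes "right_semimodule R G"
    and lin: "\<And>i. i \<in> I \<Longrightarrow> \<gamma> i \<in> lin_hom R (M i) G"
    and compat: "\<And>i j x. \<lbrakk>(i, j) \<in> r; x \<in> carrier (M i)\<rbrakk> \<Longrightarrow> \<gamma> j (\<phi> i j x) = \<gamma> i x"
  shows "\<exists>h\<in>lin_hom R (dirlim I r M \<phi>) G.
      (\<forall>i\<in>I. \<forall>x\<in>carrier (M i). h (dirlim_inj I r M \<phi> i x) = \<gamma> i x) \<and>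
      (\<forall>h'\<in>lin_hom R (dirlim I r M \<phi>) G.
        (\<forall>i\<in>I. \<forall>x\<in>carrier (M i). h' (dirlim_inj I r M \<phi> i x) = \<gamma> i x) \<longrightarrow>
        (\<forall>A\<in>carrier (dirlim I r M \<phi>). h' A = h A))"
proof -
  let ?D = "dirlim I r M \<phi>"
  define h where "h = (\<lambda>A. case (SOME p. p \<in> A) of (i, x) \<Rightarrow> \<gamma> i x)"
  have val: "h (dirlim_inj I r M \<phi> i x) = \<gamma> i x" if i: "i \<in> I" and x: "x \<in> carrier (M i)" for i x
  proof -
    obtain j y where jy: "(SOME p. p \<in> dirlim_inj I r M \<phi> i x) = (j, y)" by force
    have "(i, x) \<in> dirlim_inj I r M \<phi> i x"
      using equiv_class_self[OF dirlim_equiv] i x by (auto simp: dirlim_inj_def)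
    then have "(j, y) \<in> dirlim_inj I r M \<phi> i x" using jy by (metis someI)
    then have "((i, x), (j, y)) \<in> dirlim_cong I r M \<phi>" by (simp add: dirlim_inj_def)
    then obtain k where "y \<in> carrier (M j)" "(i, k) \<in> r" "(j, k) \<in> r" "\<phi> i k x = \<phi> j k y"
      by (auto simp: dirlim_cong_def)
    then have "\<gamma> j y = \<gamma> i x" using compat x by metis
    then show ?thesis by (simp add: h_def jy)
  qed
  have "h \<in> lin_hom R ?D G"
  proof (rule lin_homI)
    fix A assume "A \<in> carrier ?D"
    then show "h A \<in> carrier G"
      using val lin_homD(1)[OF lin] by (auto simp: dirlim_carrier)
  next
    fix A B assume *: "A \<in> carrier ?D" "B \<in> carrier ?D"
    from dirlim_cases3[OF this *(2)] obtain k x y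
      where k: "k \<in> I" "x \<in> carrier (M k)" "y \<in> carrier (M k)"
      "A = dirlim_inj I r M \<phi> k x" "B = dirlim_inj I r M \<phi> k y" .
    moreover have "x \<oplus>\<^bsub>M k\<^esub> y \<in> carrier (M k)"
      using semimod[OF k(1)] k(2,3)
      by (meson abelian_monoid.a_closed presemimodule_def right_semimodule_def)
    ultimately show "h (A \<oplus>\<^bsub>?D\<^esub> B) = h A \<oplus>\<^bsub>G\<^esub> h B"
      by (simp add: val dirlim_add lin_homD(2)[OF lin])
  next
    fix a A assume a: "a \<in> carrier R" and "A \<in> carrier ?D"
    then obtain k x where k: "k \<in> I" "x \<in> carrier (M k)" "A = dirlim_inj I r M \<phi> k x"
      by (auto simp: dirlim_carrier)
    moreover have "a \<odot>\<^bsub>M k\<^esub> x \<in> carrier (M k)"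
      using semimod[OF k(1)] k(2) a by (meson presemimodule.smult_closed right_semimodule_def)
    ultimately show "h (a \<odot>\<^bsub>?D\<^esub> A) = a \<odot>\<^bsub>G\<^esub> h A"
      using a by (simp add: val dirlim_smult lin_homD(3)[OF lin])
  qed
  then show ?thesis
    using val by (intro bexI[of _ h]) (auto simp: dirlim_carrier)
qed

end


text \<open>
  The first argument only records the types of the indices and of the elements of the \<open>M i\<close>.  A
  family of semimodules can always be placed on one type, their disjoint union.
\<close>

definition flat :: "('i \<times> 'c) itself \<Rightarrow> ('r, 'z) ring_scheme \<Rightarrow> ('r, 'f) module \<Rightarrow> bool"
  where "flat TT R F \<longleftrightarrow> right_semimodule R F \<and>
    (\<exists>(I :: 'i set) r (M :: 'i \<Rightarrow> ('r, 'c) module) \<phi>.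
      directed_system R I r M \<phi> \<and>
      (\<forall>i\<in>I. finitely_presented R (M i) \<and> projective R (M i)) \<and>
      lin_iso R (dirlim I r M \<phi>) F \<noteq> {})"


section \<open>Tensor products and uniform flatness\<close>

text \<open>
  \<open>F \<otimes>\<^sub>R N\<close> is the quotient of the free Abelian monoid on \<open>F \<times> N\<close> (finite multisets of pairs) by
  the congruence generated by the relations of a balanced map; its universal property is proved
  below (\<open>tensor_universal\<close>).
\<close>

definition balanced ::
    "('r, 'z) ring_scheme \<Rightarrow> ('r, 'f) module \<Rightarrow> ('r, 'n) module \<Rightarrow> ('g, 'y) monoid_scheme \<Rightarrow>
     ('f \<Rightarrow> 'n \<Rightarrow> 'g) \<Rightarrow> bool"
  where "balanced R F N G \<beta> \<longleftrightarrow>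
    (\<forall>x\<in>carrier F. \<forall>n\<in>carrier N. \<beta> x n \<in> carrier G) \<and>
    (\<forall>x\<in>carrier F. \<forall>y\<in>carrier F. \<forall>n\<in>carrier N. \<beta> (x \<oplus>\<^bsub>F\<^esub> y) n = \<beta> x n \<otimes>\<^bsub>G\<^esub> \<beta> y n) \<and>
    (\<forall>n\<in>carrier N. \<beta> \<zero>\<^bsub>F\<^esub> n = \<one>\<^bsub>G\<^esub>) \<and>
    (\<forall>x\<in>carrier F. \<forall>m\<in>carrier N. \<forall>n\<in>carrier N. \<beta> x (m \<oplus>\<^bsub>N\<^esub> n) = \<beta> x m \<otimes>\<^bsub>G\<^esub> \<beta> x n) \<and>
    (\<forall>x\<in>carrier F. \<beta> x \<zero>\<^bsub>N\<^esub> = \<one>\<^bsub>G\<^esub>) \<and>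
    (\<forall>a\<in>carrier R. \<forall>x\<in>carrier F. \<forall>n\<in>carrier N. \<beta> (a \<odot>\<^bsub>F\<^esub> x) n = \<beta> x (a \<odot>\<^bsub>N\<^esub> n))"

inductive_set tensor_cong ::
    "('r, 'z) ring_scheme \<Rightarrow> ('r, 'f) module \<Rightarrow> ('r, 'n) module \<Rightarrow>
     (('f \<times> 'n) multiset \<times> ('f \<times> 'n) multiset) set"
  for R :: "('r, 'z) ring_scheme" and F :: "('r, 'f) module" and N :: "('r, 'n) module"
  where
    refl: "set_mset A \<subseteq> carrier F \<times> carrier N \<Longrightarrow> (A, A) \<in> tensor_cong R F N"
  | sym: "(A, B) \<in> tensor_cong R F N \<Longrightarrow> (B, A) \<in> tensor_cong R F N"
  | trans: "\<lbrakk>(A, B) \<in> tensor_cong R F N; (B, C) \<in> tensor_cong R F N\<rbrakk>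
            \<Longrightarrow> (A, C) \<in> tensor_cong R F N"
  | add: "\<lbrakk>(A, B) \<in> tensor_cong R F N; (A', B') \<in> tensor_cong R F N\<rbrakk>
            \<Longrightarrow> (A + A', B + B') \<in> tensor_cong R F N"
  | add_left: "\<lbrakk>x \<in> carrier F; y \<in> carrier F; n \<in> carrier N\<rbrakk>
            \<Longrightarrow> ({#(x \<oplus>\<^bsub>F\<^esub> y, n)#}, {#(x, n), (y, n)#}) \<in> tensor_cong R F N"
  | zero_left: "n \<in> carrier N \<Longrightarrow> ({#(\<zero>\<^bsub>F\<^esub>, n)#}, {#}) \<in> tensor_cong R F N"
  | add_right: "\<lbrakk>x \<in> carrier F; m \<in> carrier N; n \<in> carrier N\<rbrakk>
            \<Longrightarrow> ({#(x, m \<oplus>\<^bsub>N\<^esub> n)#}, {#(x, m), (x, n)#}) \<in> tensor_cong R F N"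
  | zero_right: "x \<in> carrier F \<Longrightarrow> ({#(x, \<zero>\<^bsub>N\<^esub>)#}, {#}) \<in> tensor_cong R F N"
  | balance: "\<lbrakk>a \<in> carrier R; x \<in> carrier F; n \<in> carrier N\<rbrakk>
            \<Longrightarrow> ({#(a \<odot>\<^bsub>F\<^esub> x, n)#}, {#(x, a \<odot>\<^bsub>N\<^esub> n)#}) \<in> tensor_cong R F N"

definition tensor ::
    "('r, 'z) ring_scheme \<Rightarrow> ('r, 'f) module \<Rightarrow> ('r, 'n) module \<Rightarrow> ('f \<times> 'n) multiset set monoid"
  where "tensor R F N =
    \<lparr>carrier = {A. set_mset A \<subseteq> carrier F \<times> carrier N} // tensor_cong R F N,
     monoid.mult = (\<lambda>X Y. tensor_cong R F N `` {A + B | A B. A \<in> X \<and> B \<in> Y}),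
     one = tensor_cong R F N `` {{#}}\<rparr>"

definition pure_tensor ::
    "('r, 'z) ring_scheme \<Rightarrow> ('r, 'f) module \<Rightarrow> ('r, 'n) module \<Rightarrow> 'f \<Rightarrow> 'n \<Rightarrow> ('f \<times> 'n) multiset set"
  where "pure_tensor R F N x n = tensor_cong R F N `` {{#(x, n)#}}"

text \<open>
  \<open>tensor_map R G P g f\<close> is \<open>g \<otimes> f\<close>, where \<open>G \<otimes>\<^sub>R P\<close> is the codomain: the class of a
  formal sum of pairs is sent to the class of its image (see \<open>tensor_map_hom\<close>).
\<close>

definition tensor_map ::
    "('r, 'z) ring_scheme \<Rightarrow> ('r, 'g) module \<Rightarrow> ('r, 'p) module \<Rightarrow> ('f \<Rightarrow> 'g) \<Rightarrow> ('n \<Rightarrow> 'p) \<Rightarrow>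
     ('f \<times> 'n) multiset set \<Rightarrow> ('g \<times> 'p) multiset set"
  where "tensor_map R G P g f X = tensor_cong R G P `` (image_mset (map_prod g f) ` X)"

lemma tensor_congD:
  assumes "presemimodule R F" "presemimodule R N" "(A, B) \<in> tensor_cong R F N"
  shows "set_mset A \<subseteq> carrier F \<times> carrier N \<and> set_mset B \<subseteq> carrier F \<times> carrier N"
proof -
  interpret F: presemimodule R F by fact
  interpret N: presemimodule R N by fact
  show ?thesis using assms(3) by induction auto
qed

locale tensor_pair = F: right_semimodule R F + N: left_semimodule R N
  for R :: "('r, 'z) ring_scheme" and F :: "('r, 'f) module" and N :: "('r, 'n) module"
begin

lemma cong_equiv:
  "equiv {A. set_mset A \<subseteq> carrier F \<times> carrier N} (tensor_cong R F N)"
proof (rule equivI)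
  show "tensor_cong R F N \<subseteq>
      {A. set_mset A \<subseteq> carrier F \<times> carrier N} \<times> {A. set_mset A \<subseteq> carrier F \<times> carrier N}"
    using tensor_congD[OF F.presemimodule_axioms N.presemimodule_axioms] by auto
  show "refl_on {A. set_mset A \<subseteq> carrier F \<times> carrier N} (tensor_cong R F N)"
    by (auto simp: refl_on_def intro: tensor_cong.refl)
  show "sym (tensor_cong R F N)" by (auto intro: symI tensor_cong.sym)
  show "trans (tensor_cong R F N)" by (auto intro: transI tensor_cong.trans)
qed

abbreviation cls :: "('f \<times> 'n) multiset \<Rightarrow> ('f \<times> 'n) multiset set"
  where "cls A \<equiv> tensor_cong R F N `` {A}"

lemma cls_eq: "(A, B) \<in> tensor_cong R F N \<Longrightarrow> cls A = cls B"
  by (rule equiv_class_eq[OF cong_equiv])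

lemma cls_eq_iff:
  assumes "set_mset A \<subseteq> carrier F \<times> carrier N" "set_mset B \<subseteq> carrier F \<times> carrier N"
  shows "cls A = cls B \<longleftrightarrow> (A, B) \<in> tensor_cong R F N"
  using assms by (intro eq_equiv_class_iff[OF cong_equiv]) auto

lemma tensor_carrier:
  "carrier (tensor R F N) = cls ` {A. set_mset A \<subseteq> carrier F \<times> carrier N}"
  by (auto simp: tensor_def quotient_def)

lemma tensor_one: "\<one>\<^bsub>tensor R F N\<^esub> = cls {#}"
  by (simp add: tensor_def)

lemma tensor_mult:
  assumes "set_mset A \<subseteq> carrier F \<times> carrier N" "set_mset B \<subseteq> carrier F \<times> carrier N"
  shows "cls A \<otimes>\<^bsub>tensor R F N\<^esub> cls B = cls (A + B)"
proof -
  have "A \<in> cls A" "B \<in> cls B"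
    using assms by (auto intro: tensor_cong.refl)
  then have "{A' + B' | A' B'. A' \<in> cls A \<and> B' \<in> cls B} \<noteq> {}" by blast
  then have "tensor_cong R F N `` {A' + B' | A' B'. A' \<in> cls A \<and> B' \<in> cls B} = cls (A + B)"
    by (rule Image_eq_class[OF cong_equiv]) (auto intro!: tensor_cong.add intro: tensor_cong.sym)
  then show ?thesis by (simp add: tensor_def)
qed

lemma tensor_comm_monoid: "comm_monoid (tensor R F N)"
proof (rule comm_monoidI)
  show "\<one>\<^bsub>tensor R F N\<^esub> \<in> carrier (tensor R F N)"
    by (auto simp: tensor_carrier tensor_one)
next
  fix X Y assume "X \<in> carrier (tensor R F N)" "Y \<in> carrier (tensor R F N)"
  then show "X \<otimes>\<^bsub>tensor R F N\<^esub> Y \<in> carrier (tensor R F N)"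
    "X \<otimes>\<^bsub>tensor R F N\<^esub> Y = Y \<otimes>\<^bsub>tensor R F N\<^esub> X"
    by (auto simp: tensor_carrier tensor_mult add.commute)
next
  fix X Y Z assume "X \<in> carrier (tensor R F N)" "Y \<in> carrier (tensor R F N)"
    "Z \<in> carrier (tensor R F N)"
  then show "X \<otimes>\<^bsub>tensor R F N\<^esub> Y \<otimes>\<^bsub>tensor R F N\<^esub> Z
      = X \<otimes>\<^bsub>tensor R F N\<^esub> (Y \<otimes>\<^bsub>tensor R F N\<^esub> Z)"
    by (auto simp: tensor_carrier tensor_mult add.assoc)
next
  fix X assume "X \<in> carrier (tensor R F N)"
  then show "\<one>\<^bsub>tensor R F N\<^esub> \<otimes>\<^bsub>tensor R F N\<^esub> X = X"
    by (auto simp: tensor_carrier tensor_mult tensor_one)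
qed

lemma pure_tensor_balanced: "balanced R F N (tensor R F N) (pure_tensor R F N)"
  unfolding balanced_def pure_tensor_def
proof (intro conjI ballI)
  fix x y n assume "x \<in> carrier F" "y \<in> carrier F" "n \<in> carrier N"
  then show "cls {#(x \<oplus>\<^bsub>F\<^esub> y, n)#} = cls {#(x, n)#} \<otimes>\<^bsub>tensor R F N\<^esub> cls {#(y, n)#}"
    using cls_eq[OF tensor_cong.add_left[of x F y n N R]] by (simp add: tensor_mult add_mset_commute)
next
  fix x m n assume "x \<in> carrier F" "m \<in> carrier N" "n \<in> carrier N"
  then show "cls {#(x, m \<oplus>\<^bsub>N\<^esub> n)#} = cls {#(x, m)#} \<otimes>\<^bsub>tensor R F N\<^esub> cls {#(x, n)#}"
    using cls_eq[OF tensor_cong.add_right[of x F m N n R]] by (simp add: tensor_mult add_mset_commute)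
next
  fix n assume "n \<in> carrier N"
  then show "cls {#(\<zero>\<^bsub>F\<^esub>, n)#} = \<one>\<^bsub>tensor R F N\<^esub>"
    using cls_eq[OF tensor_cong.zero_left] by (simp add: tensor_one)
next
  fix x assume "x \<in> carrier F"
  then show "cls {#(x, \<zero>\<^bsub>N\<^esub>)#} = \<one>\<^bsub>tensor R F N\<^esub>"
    using cls_eq[OF tensor_cong.zero_right] by (simp add: tensor_one)
next
  fix a x n assume "a \<in> carrier R" "x \<in> carrier F" "n \<in> carrier N"
  then show "cls {#(a \<odot>\<^bsub>F\<^esub> x, n)#} = cls {#(x, a \<odot>\<^bsub>N\<^esub> n)#}"
    using cls_eq[OF tensor_cong.balance] by simp
next
  fix x n assume "x \<in> carrier F" "n \<in> carrier N"
  then show "cls {#(x, n)#} \<in> carrier (tensor R F N)"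
    by (simp add: tensor_carrier)
qed

lemma tensor_induct [consumes 1, case_names one pure]:
  assumes "X \<in> carrier (tensor R F N)"
    and "P \<one>\<^bsub>tensor R F N\<^esub>"
    and "\<And>x n Y. \<lbrakk>x \<in> carrier F; n \<in> carrier N; Y \<in> carrier (tensor R F N); P Y\<rbrakk>
      \<Longrightarrow> P (pure_tensor R F N x n \<otimes>\<^bsub>tensor R F N\<^esub> Y)"
  shows "P X"
proof -
  have "P (cls A)" if "set_mset A \<subseteq> carrier F \<times> carrier N" for A
    using that
  proof (induction A)
    case empty
    then show ?case using assms(2) by (simp add: tensor_one)
  next
    case (add p A)
    obtain x n where p: "p = (x, n)" by force
    have "P (pure_tensor R F N x n \<otimes>\<^bsub>tensor R F N\<^esub> cls A)"
      using add p by (intro assms(3)) (auto simp: tensor_carrier)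
    also have "pure_tensor R F N x n \<otimes>\<^bsub>tensor R F N\<^esub> cls A = cls (add_mset p A)"
      using add.prems p by (simp add: pure_tensor_def tensor_mult)
    finally show ?case .
  qed
  then show ?thesis using assms(1) by (auto simp: tensor_carrier)
qed

lemma tensor_hom_unique:
  assumes "h \<in> hom (tensor R F N) G" "h' \<in> hom (tensor R F N) G"
    and "h \<one>\<^bsub>tensor R F N\<^esub> = h' \<one>\<^bsub>tensor R F N\<^esub>"
    and "\<And>x n. \<lbrakk>x \<in> carrier F; n \<in> carrier N\<rbrakk>
      \<Longrightarrow> h (pure_tensor R F N x n) = h' (pure_tensor R F N x n)"
    and "X \<in> carrier (tensor R F N)"
  shows "h X = h' X"
  using assms(5)
proof (induction rule: tensor_induct)
  case one
  show ?case by (fact assms(3))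
next
  case (pure x n Y)
  have "pure_tensor R F N x n \<in> carrier (tensor R F N)"
    using pure pure_tensor_balanced by (auto simp: balanced_def)
  then show ?case
    using pure assms(4) hom_mult[OF assms(1)] hom_mult[OF assms(2)] by simp
qed

lemma tensor_universal:
  fixes G :: "('g, 'y) monoid_scheme"
  assumes G: "comm_monoid G" and \<beta>: "balanced R F N G \<beta>"
  shows "\<exists>h\<in>hom (tensor R F N) G. h \<one>\<^bsub>tensor R F N\<^esub> = \<one>\<^bsub>G\<^esub> \<and>
      (\<forall>x\<in>carrier F. \<forall>n\<in>carrier N. h (pure_tensor R F N x n) = \<beta> x n) \<and>
      (\<forall>h'\<in>hom (tensor R F N) G. h' \<one>\<^bsub>tensor R F N\<^esub> = \<one>\<^bsub>G\<^esub> \<and>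
        (\<forall>x\<in>carrier F. \<forall>n\<in>carrier N. h' (pure_tensor R F N x n) = \<beta> x n) \<longrightarrow>
        (\<forall>X\<in>carrier (tensor R F N). h' X = h X))"
proof -
  interpret G: comm_monoid G by fact
  let ?D = "carrier F \<times> carrier N"
  let ?T = "tensor R F N"
  define b where "b = (\<lambda>(x, n) a. if (x, n) \<in> ?D \<and> a \<in> carrier G then \<beta> x n \<otimes>\<^bsub>G\<^esub> a else a)"
  have \<beta>G: "\<beta> x n \<in> carrier G" if "x \<in> carrier F" "n \<in> carrier N" for x n
    using \<beta> that by (auto simp: balanced_def)
  interpret b: comp_fun_commute b
    by unfold_locales (auto simp: b_def fun_eq_iff \<beta>G G.m_lcomm)
  define w where "w = fold_mset b \<one>\<^bsub>G\<^esub>"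
  have w0: "w {#} = \<one>\<^bsub>G\<^esub>" by (simp add: w_def)
  have w_add: "w (add_mset p A) = b p (w A)" for p A by (simp add: w_def)
  have w_closed: "w A \<in> carrier G" for A
    by (induction A) (auto simp: w0 w_add b_def \<beta>G)
  have w_add1: "w (add_mset (x, n) A) = \<beta> x n \<otimes>\<^bsub>G\<^esub> w A"
    if "x \<in> carrier F" "n \<in> carrier N" for x n A
    using that w_closed[of A] by (simp add: w_add b_def)
  have w_plus: "w (A + B) = w A \<otimes>\<^bsub>G\<^esub> w B" if "set_mset A \<subseteq> ?D" for A B
    using that
  proof (induction A)
    case (add p A)
    then show ?case
      by (cases p) (simp add: w_add1 \<beta>G w_closed G.m_assoc)
  qed (simp add: w0 w_closed)
  have w_cong: "w A = w B" if "(A, B) \<in> tensor_cong R F N" for A B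
    using that
  proof induction
    case (add A B A' B')
    then show ?case
      using tensor_congD[OF F.presemimodule_axioms N.presemimodule_axioms] by (simp add: w_plus)
  qed (use \<beta> in \<open>simp_all add: w_add1 w0 \<beta>G balanced_def\<close>)
  define h where "h = (\<lambda>X. w (SOME A. A \<in> X))"
  have h_cls: "h (cls A) = w A" if "set_mset A \<subseteq> ?D" for A
  proof -
    have "A \<in> cls A" using that by (auto intro: tensor_cong.refl)
    then have "(SOME B. B \<in> cls A) \<in> cls A" by (rule someI)
    then show ?thesis using w_cong by (simp add: h_def)
  qed
  have hom: "h \<in> hom ?T G"
    by (rule homI) (auto simp: tensor_carrier h_cls w_closed tensor_mult w_plus)
  have one: "h \<one>\<^bsub>?T\<^esub> = \<one>\<^bsub>G\<^esub>" by (simp add: tensor_one h_cls w0)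
  have pure: "h (pure_tensor R F N x n) = \<beta> x n" if "x \<in> carrier F" "n \<in> carrier N" for x n
    using that by (simp add: pure_tensor_def h_cls w_add1 w0 \<beta>G)
  show ?thesis
  proof (intro bexI[of _ h] conjI ballI impI)
    fix h' X
    assume h': "h' \<in> hom ?T G" and X: "X \<in> carrier ?T" and
      *: "h' \<one>\<^bsub>?T\<^esub> = \<one>\<^bsub>G\<^esub> \<and>
        (\<forall>x\<in>carrier F. \<forall>n\<in>carrier N. h' (pure_tensor R F N x n) = \<beta> x n)"
    show "h' X = h X"
      by (rule tensor_hom_unique[OF h' hom _ _ X]) (use * one pure in auto)
  qed (use hom one pure in auto)
qed

end

lemma tensor_map_hom:
  assumes "tensor_pair R F N" "tensor_pair R G P"
    and g: "g \<in> lin_hom R F G" and f: "f \<in> lin_hom R N P"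
  shows "tensor_map R G P g f \<in> hom (tensor R F N) (tensor R G P)"
    and "tensor_map R G P g f \<one>\<^bsub>tensor R F N\<^esub> = \<one>\<^bsub>tensor R G P\<^esub>"
    and "\<lbrakk>x \<in> carrier F; n \<in> carrier N\<rbrakk>
      \<Longrightarrow> tensor_map R G P g f (pure_tensor R F N x n) = pure_tensor R G P (g x) (f n)"
proof -
  interpret FN: tensor_pair R F N by fact
  interpret GP: tensor_pair R G P by fact
  let ?m = "image_mset (map_prod g f)"
  note g' = lin_homD[OF g] and f' = lin_homD[OF f]
  have g0: "g \<zero>\<^bsub>F\<^esub> = \<zero>\<^bsub>G\<^esub>"
    by (rule lin_hom_zero[OF g FN.F.presemimodule_axioms GP.F.presemimodule_axioms])
  have f0: "f \<zero>\<^bsub>N\<^esub> = \<zero>\<^bsub>P\<^esub>"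
    by (rule lin_hom_zero[OF f FN.N.presemimodule_axioms GP.N.presemimodule_axioms])
  have m: "set_mset (?m A) \<subseteq> carrier G \<times> carrier P" if "set_mset A \<subseteq> carrier F \<times> carrier N" for A
    using that g'(1) f'(1) by auto
  have cong: "(?m A, ?m B) \<in> tensor_cong R G P" if "(A, B) \<in> tensor_cong R F N" for A B
    using that
  proof induction
    case (refl A)
    then show ?case by (intro tensor_cong.refl m)
  next
    case (sym A B)
    show ?case by (rule tensor_cong.sym[OF sym.IH])
  next
    case (trans A B C)
    show ?case by (rule tensor_cong.trans[OF trans.IH])
  next
    case (add A B A' B')
    show ?case using tensor_cong.add[OF add.IH] by simp
  qed (simp_all add: g' f' g0 f0 tensor_cong.add_left tensor_cong.zero_left
      tensor_cong.add_right tensor_cong.zero_right tensor_cong.balance)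
  have cls: "tensor_map R G P g f (FN.cls A) = GP.cls (?m A)"
    if "set_mset A \<subseteq> carrier F \<times> carrier N" for A
    unfolding tensor_map_def
  proof (rule Image_eq_class[OF GP.cong_equiv])
    have "A \<in> FN.cls A" using that by (auto intro: tensor_cong.refl)
    then show "?m ` FN.cls A \<noteq> {}" by blast
  next
    fix Y assume "Y \<in> ?m ` FN.cls A"
    then obtain B where B: "(A, B) \<in> tensor_cong R F N" "Y = ?m B" by auto
    show "(Y, ?m A) \<in> tensor_cong R G P"
      unfolding B(2) by (rule cong[OF tensor_cong.sym[OF B(1)]])
  qed
  show "tensor_map R G P g f \<in> hom (tensor R F N) (tensor R G P)"
  proof (rule homI)
    fix X assume "X \<in> carrier (tensor R F N)"
    then show "tensor_map R G P g f X \<in> carrier (tensor R G P)"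
      using m cls by (auto simp: FN.tensor_carrier GP.tensor_carrier simp del: set_image_mset)
  next
    fix X Y assume "X \<in> carrier (tensor R F N)" "Y \<in> carrier (tensor R F N)"
    then obtain A B where A: "X = FN.cls A" "set_mset A \<subseteq> carrier F \<times> carrier N"
      and B: "Y = FN.cls B" "set_mset B \<subseteq> carrier F \<times> carrier N"
      by (auto simp: FN.tensor_carrier)
    have "set_mset (A + B) \<subseteq> carrier F \<times> carrier N" using A B by auto
    then show "tensor_map R G P g f (X \<otimes>\<^bsub>tensor R F N\<^esub> Y)
        = tensor_map R G P g f X \<otimes>\<^bsub>tensor R G P\<^esub> tensor_map R G P g f Y"
      using A B by (simp only: FN.tensor_mult cls GP.tensor_mult m image_mset_union)
  qed
  show "tensor_map R G P g f \<one>\<^bsub>tensor R F N\<^esub> = \<one>\<^bsub>tensor R G P\<^esub>"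
    by (simp add: FN.tensor_one GP.tensor_one cls)
  show "tensor_map R G P g f (pure_tensor R F N x n) = pure_tensor R G P (g x) (f n)"
    if "x \<in> carrier F" "n \<in> carrier N"
    using that by (simp add: pure_tensor_def cls)
qed


text \<open>The first argument only records the types of the elements of \<open>L\<close>, \<open>M\<close> and \<open>N\<close>.\<close>

definition uniformly_flat ::
    "('l \<times> 'm \<times> 'n) itself \<Rightarrow> ('r, 'z) ring_scheme \<Rightarrow> ('r, 'f) module \<Rightarrow> bool"
  where "uniformly_flat TT R F \<longleftrightarrow> right_semimodule R F \<and>
    (\<forall>(L :: ('r, 'l) module) (M :: ('r, 'm) module) (N :: ('r, 'n) module) f g.
      left_semimodule R L \<and> left_semimodule R M \<and> left_semimodule R N \<and>
      f \<in> lin_hom R L M \<and> g \<in> lin_hom R M N \<and>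
      short_exact (add_monoid L) f (add_monoid M) g (add_monoid N)
      \<longrightarrow>
      short_exact (tensor R F L) (tensor_map R F M id f) (tensor R F M)
        (tensor_map R F N id g) (tensor R F N))"

end

theory Submission
  imports Defs
begin

text \<open>
  In a short exact sequence, \<open>f\<close> is injective with subtractive image; call this a normal monomorphism.
  Conversely, \<open>F \<otimes> _\<close> always preserves the cokernel part of the sequence, so it suffices that
  \<open>id \<otimes> f\<close> is again a normal monomorphism.  This holds for finitely generated projective \<open>F\<close> by a
  dual basis, and passes to directed limits because every element of \<open>F \<otimes> N\<close>, and every equality
  between two of them, already comes from some \<open>P\<^sub>i \<otimes> N\<close>.
\<close>

section \<open>Functoriality of the tensor product\<close>

text \<open>Without subtraction a trivial kernel does not give injectivity, and an equality of
  tensors is not the vanishing of a difference, so the arguments handle pairs of elements. Normality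
  has the form this requires: when the image of x in the cokernel is zero, one only gets x + f u = f
  v, and subtractivity then places x in the image of f. It mentions no third term, so it can be
  tested at each stage and passed to the limit without carrying a cokernel along.

  The obstacle is that equality in \<open>F \<otimes> N\<close> is a generated congruence: two
  formal sums are linked by a finite derivation whose intermediate terms need not come from the
  stage, or from the preimages, where the sums were given. Both the limit and the cokernel meet
  this. The derivation is lifted rule by rule along a surjection of pairs, and lifts that disagree
  on a common term are joined by relating pairs in the same fibre. For the limit such pairs merge at
  a later stage; for the cokernel they agree after adding terms from the image of f.\<close>

context tensor_pair
begin

section \<open>Pure tensors as a balanced map\<close>

lemma pure_tensor_closed [simp, intro]:
  "\<lbrakk>x \<in> carrier F; n \<in> carrier N\<rbrakk> \<Longrightarrow> pure_tensor R F N x n \<in> carrier (tensor R F N)"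
  using pure_tensor_balanced by (auto simp: balanced_def)

lemma pure_tensor_add_left:
  "\<lbrakk>x \<in> carrier F; y \<in> carrier F; n \<in> carrier N\<rbrakk> \<Longrightarrow> pure_tensor R F N (x \<oplus>\<^bsub>F\<^esub> y) n
    = pure_tensor R F N x n \<otimes>\<^bsub>tensor R F N\<^esub> pure_tensor R F N y n"
  using pure_tensor_balanced by (auto simp: balanced_def)

lemma pure_tensor_add_right:
  "\<lbrakk>x \<in> carrier F; m \<in> carrier N; n \<in> carrier N\<rbrakk> \<Longrightarrow> pure_tensor R F N x (m \<oplus>\<^bsub>N\<^esub> n)
    = pure_tensor R F N x m \<otimes>\<^bsub>tensor R F N\<^esub> pure_tensor R F N x n"
  using pure_tensor_balanced by (auto simp: balanced_def)

lemma pure_tensor_zero_left: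
  "n \<in> carrier N \<Longrightarrow> pure_tensor R F N \<zero>\<^bsub>F\<^esub> n = \<one>\<^bsub>tensor R F N\<^esub>"
  using pure_tensor_balanced by (auto simp: balanced_def)

lemma pure_tensor_zero_right:
  "x \<in> carrier F \<Longrightarrow> pure_tensor R F N x \<zero>\<^bsub>N\<^esub> = \<one>\<^bsub>tensor R F N\<^esub>"
  using pure_tensor_balanced by (auto simp: balanced_def)

lemma pure_tensor_balance:
  "\<lbrakk>a \<in> carrier R; x \<in> carrier F; n \<in> carrier N\<rbrakk> \<Longrightarrow>
    pure_tensor R F N (a \<odot>\<^bsub>F\<^esub> x) n = pure_tensor R F N x (a \<odot>\<^bsub>N\<^esub> n)"
  using pure_tensor_balanced by (auto simp: balanced_def)

lemma pure_tensor_finsum_left: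
  assumes "n \<in> carrier N" "finite K" "h \<in> K \<rightarrow> carrier F"
  shows "pure_tensor R F N (finsum F h K) n
    = finprod (tensor R F N) (\<lambda>k. pure_tensor R F N (h k) n) K"
proof -
  interpret T: comm_monoid "tensor R F N" by (rule tensor_comm_monoid)
  show ?thesis
    using assms(2,3)
  proof (induction K)
    case empty
    then show ?case using assms(1) by (simp add: pure_tensor_zero_left)
  next
    case (insert k K)
    then have "finprod (tensor R F N) (\<lambda>k. pure_tensor R F N (h k) n) (insert k K)
      = pure_tensor R F N (h k) n
        \<otimes>\<^bsub>tensor R F N\<^esub> finprod (tensor R F N) (\<lambda>k. pure_tensor R F N (h k) n) K"
      using assms(1) by (intro T.finprod_insert) auto
    then show ?case
      using insert assms(1) by (simp add: Pi_iff pure_tensor_add_left)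
  qed
qed

end

section \<open>Homomorphisms on finite sums and on classes of formal sums\<close>

lemma hom_finprod:
  assumes "comm_monoid G" "comm_monoid H" "h \<in> hom G H" "h \<one>\<^bsub>G\<^esub> = \<one>\<^bsub>H\<^esub>"
    and "finite K" "u \<in> K \<rightarrow> carrier G"
  shows "h (finprod G u K) = finprod H (\<lambda>k. h (u k)) K"
proof -
  interpret G: comm_monoid G by fact
  interpret H: comm_monoid H by fact
  show ?thesis
    using assms(5,6)
  proof (induction K)
    case (insert k K)
    then have "finprod H (\<lambda>k. h (u k)) (insert k K) = h (u k) \<otimes>\<^bsub>H\<^esub> finprod H (\<lambda>k. h (u k)) K"
      using hom_in_carrier[OF assms(3)] by (intro H.finprod_insert) auto
    then show ?case
      using insert by (simp add: Pi_iff hom_mult[OF assms(3)])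
  qed (simp add: assms(4))
qed

text \<open>This turns an equality between images of tensors into membership of two explicit
  multisets in \<open>tensor_cong\<close>, where the derivation can be inspected. Since the map is a
  homomorphism, it can be computed by adding one pair at a time.\<close>

lemma tensor_map_cls:
  assumes FN: "tensor_pair R F N" and GP: "tensor_pair R G P"
    and g: "g \<in> lin_hom R F G" and f: "f \<in> lin_hom R N P"
    and A: "set_mset A \<subseteq> carrier F \<times> carrier N"
  shows "tensor_map R G P g f (tensor_cong R F N `` {A})
    = tensor_cong R G P `` {image_mset (map_prod g f) A}"
  using A
proof (induction A)
  case empty
  then show ?case
    using tensor_map_hom(2)[OF FN GP g f]
    by (simp add: tensor_pair.tensor_one[OF FN] tensor_pair.tensor_one[OF GP])
next
  case (add p A)
  obtain x n where p: "p = (x, n)" by force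
  have xn: "x \<in> carrier F" "n \<in> carrier N" using add.prems p by auto
  have gf: "g x \<in> carrier G" "f n \<in> carrier P"
    using xn lin_homD(1)[OF g] lin_homD(1)[OF f] by auto
  have *: "set_mset (image_mset (map_prod g f) A) \<subseteq> carrier G \<times> carrier P"
    using add.prems lin_homD(1)[OF g] lin_homD(1)[OF f] by auto
  have cl: "tensor_cong R F N `` {A} \<in> carrier (tensor R F N)"
    using add.prems by (auto simp: tensor_pair.tensor_carrier[OF FN])
  have "tensor_cong R F N `` {add_mset p A}
    = pure_tensor R F N x n \<otimes>\<^bsub>tensor R F N\<^esub> tensor_cong R F N `` {A}"
    using add.prems xn p by (simp add: pure_tensor_def tensor_pair.tensor_mult[OF FN])
  then have "tensor_map R G P g f (tensor_cong R F N `` {add_mset p A})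
    = pure_tensor R G P (g x) (f n) \<otimes>\<^bsub>tensor R G P\<^esub> tensor_map R G P g f (tensor_cong R F N `` {A})"
    using xn cl tensor_pair.pure_tensor_closed[OF FN]
    by (simp add: hom_mult[OF tensor_map_hom(1)[OF FN GP g f]] tensor_map_hom(3)[OF FN GP g f])
  also have "\<dots> = tensor_cong R G P `` {image_mset (map_prod g f) (add_mset p A)}"
    using add p gf * by (simp add: pure_tensor_def tensor_pair.tensor_mult[OF GP] del: set_image_mset)
  finally show ?case .
qed

lemma tensor_map_comp:
  assumes FN: "tensor_pair R F N" and GP: "tensor_pair R G P" and HQ: "tensor_pair R H Q"
    and g: "g \<in> lin_hom R F G" and f: "f \<in> lin_hom R N P"
    and g': "g' \<in> lin_hom R G H" and f': "f' \<in> lin_hom R P Q"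
    and X: "X \<in> carrier (tensor R F N)"
  shows "tensor_map R H Q g' f' (tensor_map R G P g f X)
    = tensor_map R H Q (\<lambda>x. g' (g x)) (\<lambda>n. f' (f n)) X"
proof -
  obtain A where A: "X = tensor_cong R F N `` {A}" "set_mset A \<subseteq> carrier F \<times> carrier N"
    using X by (auto simp: tensor_pair.tensor_carrier[OF FN])
  have "set_mset (image_mset (map_prod g f) A) \<subseteq> carrier G \<times> carrier P"
    using A lin_homD(1)[OF g] lin_homD(1)[OF f] by auto
  then show ?thesis
    using A(2) unfolding A(1)
    by (simp add: tensor_map_cls[OF FN GP g f] tensor_map_cls[OF GP HQ g' f']
        tensor_map_cls[OF FN HQ lin_hom_comp[OF g g'] lin_hom_comp[OF f f']]
        multiset.map_comp o_def map_prod_def case_prod_unfold del: set_image_mset)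
qed

lemma id_lin_hom: "id \<in> lin_hom R M M" "(\<lambda>x. x) \<in> lin_hom R M M"
  by (auto intro: lin_homI)

text \<open>Each of the two maps acts on one factor only, so both composites are
  \<open>g \<otimes> f\<close>.\<close>

lemma tensor_map_commute:
  assumes FL: "tensor_pair R F L" and FM: "tensor_pair R F M"
    and GL: "tensor_pair R G L" and GM: "tensor_pair R G M"
    and g: "g \<in> lin_hom R F G" and f: "f \<in> lin_hom R L M"
    and X: "X \<in> carrier (tensor R F L)"
  shows "tensor_map R G M g id (tensor_map R F M id f X)
    = tensor_map R G M id f (tensor_map R G L g id X)"
  by (simp add: tensor_map_comp[OF FL FM GM id_lin_hom(1) f g id_lin_hom(1) X]
      tensor_map_comp[OF FL GL GM g id_lin_hom(1) id_lin_hom(1) f X])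

text \<open>
  To transport a relation along \<open>F \<otimes> N\<close> it suffices to lift pairs along a surjection \<open>h\<close>: a congruence
  \<open>\<rho>\<close> upstairs that identifies the fibres of \<open>h\<close> and lifts the generating relations contains every
  pair lying above the tensor congruence.
\<close>

lemma tensor_cong_lift:
  fixes h :: "'d \<Rightarrow> 'f \<times> 'n" and \<rho> :: "'d multiset \<Rightarrow> 'd multiset \<Rightarrow> bool"
  assumes surj: "carrier F \<times> carrier N \<subseteq> h ` D"
    and empty: "\<rho> {#} {#}"
    and sym: "\<And>A B. \<rho> A B \<Longrightarrow> \<rho> B A"
    and trans: "\<And>A B C. \<lbrakk>set_mset A \<subseteq> D; set_mset B \<subseteq> D; set_mset C \<subseteq> D; \<rho> A B; \<rho> B C\<rbrakk> \<Longrightarrow> \<rho> A C"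
    and add: "\<And>A B A' B'. \<lbrakk>set_mset A \<subseteq> D; set_mset B \<subseteq> D; set_mset A' \<subseteq> D; set_mset B' \<subseteq> D;
        \<rho> A B; \<rho> A' B'\<rbrakk> \<Longrightarrow> \<rho> (A + A') (B + B')"
    and fibre: "\<And>p q. \<lbrakk>p \<in> D; q \<in> D; h p = h q\<rbrakk> \<Longrightarrow> \<rho> {#p#} {#q#}"
    and add_left: "\<And>x y n. \<lbrakk>x \<in> carrier F; y \<in> carrier F; n \<in> carrier N\<rbrakk> \<Longrightarrow>
        \<exists>p\<in>D. \<exists>q\<in>D. \<exists>s\<in>D. h p = (x \<oplus>\<^bsub>F\<^esub> y, n) \<and> h q = (x, n) \<and> h s = (y, n) \<and> \<rho> {#p#} {#q, s#}"
    and zero_left: "\<And>n. n \<in> carrier N \<Longrightarrow> \<exists>p\<in>D. h p = (\<zero>\<^bsub>F\<^esub>, n) \<and> \<rho> {#p#} {#}"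
    and add_right: "\<And>x m n. \<lbrakk>x \<in> carrier F; m \<in> carrier N; n \<in> carrier N\<rbrakk> \<Longrightarrow>
        \<exists>p\<in>D. \<exists>q\<in>D. \<exists>s\<in>D. h p = (x, m \<oplus>\<^bsub>N\<^esub> n) \<and> h q = (x, m) \<and> h s = (x, n) \<and> \<rho> {#p#} {#q, s#}"
    and zero_right: "\<And>x. x \<in> carrier F \<Longrightarrow> \<exists>p\<in>D. h p = (x, \<zero>\<^bsub>N\<^esub>) \<and> \<rho> {#p#} {#}"
    and balance: "\<And>a x n. \<lbrakk>a \<in> carrier R; x \<in> carrier F; n \<in> carrier N\<rbrakk> \<Longrightarrow>
        \<exists>p\<in>D. \<exists>q\<in>D. h p = (a \<odot>\<^bsub>F\<^esub> x, n) \<and> h q = (x, a \<odot>\<^bsub>N\<^esub> n) \<and> \<rho> {#p#} {#q#}"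
    and A: "set_mset A \<subseteq> D" and B: "set_mset B \<subseteq> D"
    and AB: "(image_mset h A, image_mset h B) \<in> tensor_cong R F N"
  shows "\<rho> A B"
proof -
  \<comment> \<open>Multisets with the same image can be matched element by element, and
    \<open>add\<close> combines the resulting instances of \<open>fibre\<close>.\<close>
  have fibres: "\<rho> A B"
    if "set_mset A \<subseteq> D" "set_mset B \<subseteq> D" "image_mset h A = image_mset h B" for A B
    using that
  proof (induction A arbitrary: B)
    case empty
    then show ?case using assms(2) by simp
  next
    case (add p A)
    obtain q B' where B': "B = add_mset q B'" "h q = h p" "image_mset h B' = image_mset h A"
      using add.prems(3) by (metis image_mset_add_mset msed_map_invR)
    have "\<rho> {#p#} {#q#}" using add.prems B' by (intro fibre) auto
    moreover have "\<rho> A B'" using add B' by auto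
    ultimately have "\<rho> ({#p#} + A) ({#q#} + B')"
      using add.prems B' by (intro assms(5)) auto
    then show ?case using B' by simp
  qed
  have lift: "\<exists>A. set_mset A \<subseteq> D \<and> image_mset h A = X"
    if "set_mset X \<subseteq> carrier F \<times> carrier N" for X
    using that
  proof (induction X)
    case (add p X)
    then obtain A d where "set_mset A \<subseteq> D" "image_mset h A = X" "d \<in> D" "h d = p"
      using surj by auto
    then show ?case by (intro exI[of _ "add_mset d A"]) auto
  qed auto
  \<comment> \<open>The induction only produces some pair of related lifts, because the generating
    relations are assumed to lift for suitable choices and not for all. The given lifts are reached
    afterwards through \<open>fibres\<close>.\<close>
  have main: "\<exists>A B. set_mset A \<subseteq> D \<and> set_mset B \<subseteq> D \<and> image_mset h A = X \<and> image_mset h B = Y \<and> \<rho> A B"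
    if "(X, Y) \<in> tensor_cong R F N" for X Y
    using that
  proof induction
    case (refl X)
    then show ?case using lift fibres by blast
  next
    case (sym X Y)
    then show ?case using assms(3) by blast
  next
    case (trans X Y Z)
    then obtain A B B' C where *: "set_mset A \<subseteq> D" "set_mset B \<subseteq> D" "set_mset B' \<subseteq> D"
      "set_mset C \<subseteq> D" "image_mset h A = X" "image_mset h B = Y" "image_mset h B' = Y"
      "image_mset h C = Z" "\<rho> A B" "\<rho> B' C" by blast
    \<comment> \<open>The two induction hypotheses may lift the middle term differently; equal
      images make the two lifts related.\<close>
    have "\<rho> B B'" using * fibres by auto
    then have "\<rho> A C" using * assms(4) by meson
    then show ?case using * by blast
  next
    case (add X Y X' Y')
    then obtain A B A' B' where *: "set_mset A \<subseteq> D" "set_mset B \<subseteq> D" "set_mset A' \<subseteq> D"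
      "set_mset B' \<subseteq> D" "image_mset h A = X" "image_mset h B = Y" "image_mset h A' = X'"
      "image_mset h B' = Y'" "\<rho> A B" "\<rho> A' B'" by blast
    then have "\<rho> (A + A') (B + B')" by (intro assms(5))
    then show ?case using * by (intro exI[of _ "A + A'"] exI[of _ "B + B'"]) auto
  next
    case (add_left x y n)
    then obtain p q s where "p \<in> D" "q \<in> D" "s \<in> D" "h p = (x \<oplus>\<^bsub>F\<^esub> y, n)" "h q = (x, n)"
      "h s = (y, n)" "\<rho> {#p#} {#q, s#}" using assms(7) by metis
    then show ?case by (intro exI[of _ "{#p#}"] exI[of _ "{#q, s#}"]) auto
  next
    case (zero_left n)
    then obtain p where "p \<in> D" "h p = (\<zero>\<^bsub>F\<^esub>, n)" "\<rho> {#p#} {#}" using assms(8) by metis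
    then show ?case by (intro exI[of _ "{#p#}"] exI[of _ "{#}"]) auto
  next
    case (add_right x m n)
    then obtain p q s where "p \<in> D" "q \<in> D" "s \<in> D" "h p = (x, m \<oplus>\<^bsub>N\<^esub> n)" "h q = (x, m)"
      "h s = (x, n)" "\<rho> {#p#} {#q, s#}" using assms(9) by metis
    then show ?case by (intro exI[of _ "{#p#}"] exI[of _ "{#q, s#}"]) auto
  next
    case (zero_right x)
    then obtain p where "p \<in> D" "h p = (x, \<zero>\<^bsub>N\<^esub>)" "\<rho> {#p#} {#}" using assms(10) by metis
    then show ?case by (intro exI[of _ "{#p#}"] exI[of _ "{#}"]) auto
  next
    case (balance a x n)
    then obtain p q where "p \<in> D" "q \<in> D" "h p = (a \<odot>\<^bsub>F\<^esub> x, n)" "h q = (x, a \<odot>\<^bsub>N\<^esub> n)"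
      "\<rho> {#p#} {#q#}" using assms(11) by metis
    then show ?case by (intro exI[of _ "{#p#}"] exI[of _ "{#q#}"]) auto
  qed
  from main[OF AB] obtain A' B' where *: "set_mset A' \<subseteq> D" "set_mset B' \<subseteq> D"
    "image_mset h A' = image_mset h A" "image_mset h B' = image_mset h B" "\<rho> A' B'" by blast
  have "\<rho> A A'" "\<rho> B' B" using * A B by (auto intro!: fibres)
  then show ?thesis using * A B trans by meson
qed


section \<open>Normal monomorphisms\<close>

text \<open>For a homomorphism the image is a submonoid, and the second clause says that it is
  subtractive: a summand x lies in it as soon as a and x + a do. These are the kernels of
  homomorphisms among submonoids, up to the choice of a target.\<close>

definition normal_mono ::
    "('a, 'x) monoid_scheme \<Rightarrow> ('b, 'y) monoid_scheme \<Rightarrow> ('a \<Rightarrow> 'b) \<Rightarrow> bool"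
  where "normal_mono L M f \<longleftrightarrow> inj_on f (carrier L) \<and>
    (\<forall>x\<in>carrier M. \<forall>u\<in>carrier L. \<forall>v\<in>carrier L.
      x \<otimes>\<^bsub>M\<^esub> f u = f v \<longrightarrow> x \<in> f ` carrier L)"

text \<open>Exactness at L leaves only zero in the kernel of f, so k-uniformity of f becomes
  injectivity. The image of f is the kernel of g, and g x + 0 = 0 forces g x = 0.\<close>

lemma short_exact_normal_mono:
  assumes ex: "short_exact L f M g N" and L: "comm_monoid L" and M: "comm_monoid M" and N: "comm_monoid N"
    and g: "g \<in> hom M N"
  shows "normal_mono L M f"
proof -
  interpret L: comm_monoid L by fact
  interpret M: comm_monoid M by fact
  interpret N: comm_monoid N by fact
  have k: "kernel L M f = {\<one>\<^bsub>L\<^esub>}" and ku: "k_uniform L M f"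
    and im: "f ` carrier L = kernel M N g"
    using ex by (auto simp: short_exact_def exact_at_def)
  have "inj_on f (carrier L)"
    using ku unfolding k_uniform_def k by (auto simp: inj_on_def)
  moreover have "x \<in> f ` carrier L"
    if x: "x \<in> carrier M" and u: "u \<in> carrier L" and v: "v \<in> carrier L" and eq: "x \<otimes>\<^bsub>M\<^esub> f u = f v" for x u v
  proof -
    have fu: "f u \<in> carrier M" "g (f u) = \<one>\<^bsub>N\<^esub>" and fv: "g (f v) = \<one>\<^bsub>N\<^esub>"
      using im u v by (auto simp: kernel_def)
    have "g x \<otimes>\<^bsub>N\<^esub> \<one>\<^bsub>N\<^esub> = \<one>\<^bsub>N\<^esub>"
      using hom_mult[OF g x fu(1)] fu fv eq by simp
    then have "g x = \<one>\<^bsub>N\<^esub>" using hom_in_carrier[OF g x] by simp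
    then show ?thesis using x im by (simp add: kernel_def)
  qed
  ultimately show ?thesis unfolding normal_mono_def by blast
qed

text \<open>The assumption \<open>coker\<close> says that g identifies only elements that agree
  after adding terms from the image of f. Once that image is known to be the kernel of g, this is
  literally k-uniformity of g.\<close>

lemma normal_mono_short_exact:
  assumes L: "comm_monoid L" and M: "comm_monoid M" and N: "comm_monoid N"
    and f: "normal_mono L M f" "f \<in> hom L M" "f \<one>\<^bsub>L\<^esub> = \<one>\<^bsub>M\<^esub>"
    and g: "g \<in> hom M N" "g \<one>\<^bsub>M\<^esub> = \<one>\<^bsub>N\<^esub>" "g ` carrier M = carrier N"
    and gf: "\<And>u. u \<in> carrier L \<Longrightarrow> g (f u) = \<one>\<^bsub>N\<^esub>"
    and coker: "\<And>x y. \<lbrakk>x \<in> carrier M; y \<in> carrier M; g x = g y\<rbrakk> \<Longrightarrow>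
        \<exists>u\<in>carrier L. \<exists>v\<in>carrier L. x \<otimes>\<^bsub>M\<^esub> f u = y \<otimes>\<^bsub>M\<^esub> f v"
  shows "short_exact L f M g N"
proof -
  interpret L: comm_monoid L by fact
  interpret M: comm_monoid M by fact
  interpret N: comm_monoid N by fact
  have inj: "inj_on f (carrier L)"
    and sub: "\<And>x u v. \<lbrakk>x \<in> carrier M; u \<in> carrier L; v \<in> carrier L; x \<otimes>\<^bsub>M\<^esub> f u = f v\<rbrakk>
      \<Longrightarrow> x \<in> f ` carrier L"
    using f(1) unfolding normal_mono_def by blast+
  have fL: "f u \<in> carrier M" if "u \<in> carrier L" for u
    using hom_in_carrier[OF f(2) that] .
  have kf: "kernel L M f = {\<one>\<^bsub>L\<^esub>}"
    using inj f(3) L.one_closed unfolding kernel_def inj_on_def by fastforce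
  have kg: "kernel M N g = f ` carrier L"
  proof
    show "f ` carrier L \<subseteq> kernel M N g" using fL gf by (auto simp: kernel_def)
    show "kernel M N g \<subseteq> f ` carrier L"
    proof
      fix x assume "x \<in> kernel M N g"
      \<comment> \<open>Comparing x with zero through \<open>coker\<close> gives x + f u = f v;
        subtractivity then yields a preimage of x.\<close>
      then have x: "x \<in> carrier M" "g x = g \<one>\<^bsub>M\<^esub>" by (auto simp: kernel_def g(2))
      with coker[of x "\<one>\<^bsub>M\<^esub>"] obtain u v
        where uv: "u \<in> carrier L" "v \<in> carrier L" "x \<otimes>\<^bsub>M\<^esub> f u = \<one>\<^bsub>M\<^esub> \<otimes>\<^bsub>M\<^esub> f v" by auto
      then show "x \<in> f ` carrier L" using sub[OF x(1) uv(1,2)] fL by simp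
    qed
  qed
  have "k_uniform L M f"
    using inj unfolding k_uniform_def kf by (auto simp: inj_on_def)
  moreover have "k_uniform M N g"
    using coker unfolding k_uniform_def kg by (auto simp: image_iff)
  \<comment> \<open>The kernel of the zero map is everything, so m1 and m2 can correct each other:
    m1 + m2 = m2 + m1.\<close>
  moreover have "k_uniform N (singleton_group ()) (\<lambda>_. ())"
    unfolding k_uniform_def kernel_def using N.m_comm by auto
  moreover have "kernel N (singleton_group ()) (\<lambda>_. ()) = carrier N"
    by (auto simp: kernel_def)
  ultimately show ?thesis
    unfolding short_exact_def exact_at_def using kf kg g(3) by simp
qed


section \<open>Projective semimodules\<close>

context tensor_pair
begin

text \<open>The coordinate \<open>e k\<close> is induced by the balanced map sending (x, n) to
  \<open>\<xi> k x\<close> acting on n. The reconstruction formula holds on pure tensors because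
  balancing moves \<open>\<xi> k x\<close> to the left factor, where the sum over k becomes the
  expansion of x in the basis; additivity extends it to all tensors.\<close>

lemma tensor_coordinates:
  assumes K: "finite K" and b: "b \<in> K \<rightarrow> carrier F"
    and closed: "\<And>k x. \<lbrakk>k \<in> K; x \<in> carrier F\<rbrakk> \<Longrightarrow> \<xi> k x \<in> carrier R"
    and add: "\<And>k x y. \<lbrakk>k \<in> K; x \<in> carrier F; y \<in> carrier F\<rbrakk> \<Longrightarrow> \<xi> k (x \<oplus>\<^bsub>F\<^esub> y) = \<xi> k x \<oplus>\<^bsub>R\<^esub> \<xi> k y"
    and smult: "\<And>k a x. \<lbrakk>k \<in> K; a \<in> carrier R; x \<in> carrier F\<rbrakk> \<Longrightarrow> \<xi> k (a \<odot>\<^bsub>F\<^esub> x) = \<xi> k x \<otimes>\<^bsub>R\<^esub> a"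
    and basis: "\<And>x. x \<in> carrier F \<Longrightarrow> finsum F (\<lambda>k. \<xi> k x \<odot>\<^bsub>F\<^esub> b k) K = x"
  obtains e where "\<And>k. k \<in> K \<Longrightarrow> e k \<in> hom (tensor R F N) (add_monoid N)"
    and "\<And>k. k \<in> K \<Longrightarrow> e k \<one>\<^bsub>tensor R F N\<^esub> = \<zero>\<^bsub>N\<^esub>"
    and "\<And>k x n. \<lbrakk>k \<in> K; x \<in> carrier F; n \<in> carrier N\<rbrakk>
      \<Longrightarrow> e k (pure_tensor R F N x n) = \<xi> k x \<odot>\<^bsub>N\<^esub> n"
    and "\<And>X. X \<in> carrier (tensor R F N)
      \<Longrightarrow> finprod (tensor R F N) (\<lambda>k. pure_tensor R F N (b k) (e k X)) K = X"
proof -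
  interpret T: comm_monoid "tensor R F N" by (rule tensor_comm_monoid)
  have "\<exists>e\<in>hom (tensor R F N) (add_monoid N). e \<one>\<^bsub>tensor R F N\<^esub> = \<zero>\<^bsub>N\<^esub> \<and>
      (\<forall>x\<in>carrier F. \<forall>n\<in>carrier N. e (pure_tensor R F N x n) = \<xi> k x \<odot>\<^bsub>N\<^esub> n)"
    if k: "k \<in> K" for k
  proof -
    \<comment> \<open>Additivity alone does not send zero to zero when there is no cancellation, so
      zero is written as a multiple by the scalar zero.\<close>
    have "\<xi> k \<zero>\<^bsub>F\<^esub> = \<xi> k (\<zero>\<^bsub>R\<^esub> \<odot>\<^bsub>F\<^esub> \<zero>\<^bsub>F\<^esub>)" by simp
    also have "\<dots> = \<zero>\<^bsub>R\<^esub>"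
      using k closed[of k "\<zero>\<^bsub>F\<^esub>"] by (subst smult) auto
    finally have "balanced R F N (add_monoid N) (\<lambda>x n. \<xi> k x \<odot>\<^bsub>N\<^esub> n)"
      unfolding balanced_def using k closed
      by (simp add: add smult N.smult_l_distr N.smult_r_distr N.left_assoc)
    from tensor_universal[OF N.add.comm_monoid_axioms this] show ?thesis
      by auto
  qed
  then obtain e where e: "\<And>k. k \<in> K \<Longrightarrow> e k \<in> hom (tensor R F N) (add_monoid N)"
    "\<And>k. k \<in> K \<Longrightarrow> e k \<one>\<^bsub>tensor R F N\<^esub> = \<zero>\<^bsub>N\<^esub>"
    "\<And>k x n. \<lbrakk>k \<in> K; x \<in> carrier F; n \<in> carrier N\<rbrakk>
      \<Longrightarrow> e k (pure_tensor R F N x n) = \<xi> k x \<odot>\<^bsub>N\<^esub> n" by metis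
  have eN: "e k X \<in> carrier N" if "k \<in> K" "X \<in> carrier (tensor R F N)" for k X
    using hom_in_carrier[OF e(1)] that by fastforce
  have b': "b k \<in> carrier F" if "k \<in> K" for k using b that by auto
  have "finprod (tensor R F N) (\<lambda>k. pure_tensor R F N (b k) (e k X)) K = X"
    if "X \<in> carrier (tensor R F N)" for X
    using that
  proof (induction rule: tensor_induct)
    case one
    have "finprod (tensor R F N) (\<lambda>k. pure_tensor R F N (b k) (e k \<one>\<^bsub>tensor R F N\<^esub>)) K
      = finprod (tensor R F N) (\<lambda>k. \<one>\<^bsub>tensor R F N\<^esub>) K"
      by (rule T.finprod_cong') (auto simp: e(2) b' pure_tensor_zero_right)
    then show ?case by simp
  next
    case (pure x n Y)
    have xn: "\<xi> k x \<odot>\<^bsub>F\<^esub> b k \<in> carrier F" if "k \<in> K" for k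
      using that pure closed b' by simp
    have "finprod (tensor R F N) (\<lambda>k. pure_tensor R F N (b k)
        (e k (pure_tensor R F N x n \<otimes>\<^bsub>tensor R F N\<^esub> Y))) K
      = finprod (tensor R F N) (\<lambda>k. pure_tensor R F N (\<xi> k x \<odot>\<^bsub>F\<^esub> b k) n
          \<otimes>\<^bsub>tensor R F N\<^esub> pure_tensor R F N (b k) (e k Y)) K"
    proof (rule T.finprod_cong')
      fix k assume k: "k \<in> K"
      have "e k (pure_tensor R F N x n \<otimes>\<^bsub>tensor R F N\<^esub> Y) = \<xi> k x \<odot>\<^bsub>N\<^esub> n \<oplus>\<^bsub>N\<^esub> e k Y"
        using hom_mult[OF e(1)[OF k], of "pure_tensor R F N x n" Y] pure k by (simp add: e(3))
      then show "pure_tensor R F N (b k) (e k (pure_tensor R F N x n \<otimes>\<^bsub>tensor R F N\<^esub> Y))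
        = pure_tensor R F N (\<xi> k x \<odot>\<^bsub>F\<^esub> b k) n \<otimes>\<^bsub>tensor R F N\<^esub> pure_tensor R F N (b k) (e k Y)"
        using k pure b' eN closed by (simp add: pure_tensor_add_right pure_tensor_balance)
    qed (use pure eN b' xn in auto)
    also have "\<dots> = finprod (tensor R F N) (\<lambda>k. pure_tensor R F N (\<xi> k x \<odot>\<^bsub>F\<^esub> b k) n) K
        \<otimes>\<^bsub>tensor R F N\<^esub> finprod (tensor R F N) (\<lambda>k. pure_tensor R F N (b k) (e k Y)) K"
      by (rule T.finprod_multf) (use pure eN b' xn in auto)
    also have "\<dots> = pure_tensor R F N x n \<otimes>\<^bsub>tensor R F N\<^esub> Y"
      using pure_tensor_finsum_left[of n K "\<lambda>k. \<xi> k x \<odot>\<^bsub>F\<^esub> b k"] pure xn K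
      by (simp add: basis)
    finally show ?case .
  qed
  with e show thesis by (rule that)
qed

end

text \<open>
  A dual basis \<open>(b, \<xi>)\<close> of \<open>P\<close> yields coordinates \<open>P \<otimes> N \<rightarrow> N\<close> that are natural in \<open>N\<close> and determine
  the elements of \<open>P \<otimes> N\<close>, so normality can be checked coordinatewise.
\<close>

lemma dual_basis_normal_mono:
  fixes R :: "('r, 'z) ring_scheme" and P :: "('r, 'p) module"
    and L :: "('r, 'l) module" and M :: "('r, 'm) module"
  assumes P: "right_semimodule R P" and L: "left_semimodule R L" and M: "left_semimodule R M"
    and f: "f \<in> lin_hom R L M" and nm: "normal_mono (add_monoid L) (add_monoid M) f"
    and K: "finite K" and b: "b \<in> K \<rightarrow> carrier P"
    and closed: "\<And>k x. \<lbrakk>k \<in> K; x \<in> carrier P\<rbrakk> \<Longrightarrow> \<xi> k x \<in> carrier R"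
    and add: "\<And>k x y. \<lbrakk>k \<in> K; x \<in> carrier P; y \<in> carrier P\<rbrakk> \<Longrightarrow> \<xi> k (x \<oplus>\<^bsub>P\<^esub> y) = \<xi> k x \<oplus>\<^bsub>R\<^esub> \<xi> k y"
    and smult: "\<And>k a x. \<lbrakk>k \<in> K; a \<in> carrier R; x \<in> carrier P\<rbrakk> \<Longrightarrow> \<xi> k (a \<odot>\<^bsub>P\<^esub> x) = \<xi> k x \<otimes>\<^bsub>R\<^esub> a"
    and basis: "\<And>x. x \<in> carrier P \<Longrightarrow> finsum P (\<lambda>k. \<xi> k x \<odot>\<^bsub>P\<^esub> b k) K = x"
  shows "normal_mono (tensor R P L) (tensor R P M) (tensor_map R P M id f)"
proof -
  interpret L: left_semimodule R L by fact
  interpret M: left_semimodule R M by fact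
  interpret PL: tensor_pair R P L by (intro tensor_pair.intro P L)
  interpret PM: tensor_pair R P M by (intro tensor_pair.intro P M)
  interpret TL: comm_monoid "tensor R P L" by (rule PL.tensor_comm_monoid)
  interpret TM: comm_monoid "tensor R P M" by (rule PM.tensor_comm_monoid)
  let ?f = "tensor_map R P M id f"
  note Tf = tensor_map_hom[OF PL.tensor_pair_axioms PM.tensor_pair_axioms id_lin_hom(1) f]
  have f0: "f \<zero>\<^bsub>L\<^esub> = \<zero>\<^bsub>M\<^esub>"
    by (rule lin_hom_zero[OF f L.presemimodule_axioms M.presemimodule_axioms])
  obtain d where d: "\<And>k. k \<in> K \<Longrightarrow> d k \<in> hom (tensor R P L) (add_monoid L)"
    "\<And>k. k \<in> K \<Longrightarrow> d k \<one>\<^bsub>tensor R P L\<^esub> = \<zero>\<^bsub>L\<^esub>"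
    "\<And>k x n. \<lbrakk>k \<in> K; x \<in> carrier P; n \<in> carrier L\<rbrakk> \<Longrightarrow> d k (pure_tensor R P L x n) = \<xi> k x \<odot>\<^bsub>L\<^esub> n"
    "\<And>X. X \<in> carrier (tensor R P L)
      \<Longrightarrow> finprod (tensor R P L) (\<lambda>k. pure_tensor R P L (b k) (d k X)) K = X"
    using PL.tensor_coordinates[OF K b closed add smult basis] by blast
  obtain e where e: "\<And>k. k \<in> K \<Longrightarrow> e k \<in> hom (tensor R P M) (add_monoid M)"
    "\<And>k. k \<in> K \<Longrightarrow> e k \<one>\<^bsub>tensor R P M\<^esub> = \<zero>\<^bsub>M\<^esub>"
    "\<And>k x n. \<lbrakk>k \<in> K; x \<in> carrier P; n \<in> carrier M\<rbrakk> \<Longrightarrow> e k (pure_tensor R P M x n) = \<xi> k x \<odot>\<^bsub>M\<^esub> n"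
    "\<And>X. X \<in> carrier (tensor R P M)
      \<Longrightarrow> finprod (tensor R P M) (\<lambda>k. pure_tensor R P M (b k) (e k X)) K = X"
    using PM.tensor_coordinates[OF K b closed add smult basis] by blast
  have dL: "d k X \<in> carrier L" if "k \<in> K" "X \<in> carrier (tensor R P L)" for k X
    using hom_in_carrier[OF d(1)] that by fastforce
  have eM: "e k X \<in> carrier M" if "k \<in> K" "X \<in> carrier (tensor R P M)" for k X
    using hom_in_carrier[OF e(1)] that by fastforce
  have f_hom: "f \<in> hom (add_monoid L) (add_monoid M)"
    using f by (simp add: lin_hom_def)
  \<comment> \<open>Both sides are homomorphisms in X that send zero to zero and a pure tensor of x
    and n to \<open>\<xi> k x\<close> acting on f n, so uniqueness on pure tensors applies.\<close>
  have nat: "e k (?f X) = f (d k X)" if k: "k \<in> K" and X: "X \<in> carrier (tensor R P L)" for k X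
  proof -
    have "(e k \<circ> ?f) X = (f \<circ> d k) X"
    proof (rule PL.tensor_hom_unique[OF _ _ _ _ X])
      show "e k \<circ> ?f \<in> hom (tensor R P L) (add_monoid M)"
        by (rule hom_compose[OF Tf(1) e(1)[OF k]])
      show "f \<circ> d k \<in> hom (tensor R P L) (add_monoid M)"
        by (rule hom_compose[OF d(1)[OF k] f_hom])
    qed (use k in \<open>simp_all add: Tf(2,3)[unfolded id_def] id_def d(2,3) e(2,3) f0 lin_homD[OF f] closed\<close>)
    then show ?thesis by simp
  qed
  have inj: "inj_on f (carrier L)"
    and sub: "\<And>x u v. \<lbrakk>x \<in> carrier M; u \<in> carrier L; v \<in> carrier L; x \<oplus>\<^bsub>M\<^esub> f u = f v\<rbrakk>
      \<Longrightarrow> x \<in> f ` carrier L"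
    using nm unfolding normal_mono_def by auto
  have "inj_on ?f (carrier (tensor R P L))"
  proof (rule inj_onI)
    fix X Y assume X: "X \<in> carrier (tensor R P L)" and Y: "Y \<in> carrier (tensor R P L)" and eq: "?f X = ?f Y"
    have "d k X = d k Y" if k: "k \<in> K" for k
      using nat[OF k X] nat[OF k Y] eq inj_onD[OF inj _ dL[OF k X] dL[OF k Y]] by simp
    then have "finprod (tensor R P L) (\<lambda>k. pure_tensor R P L (b k) (d k X)) K
      = finprod (tensor R P L) (\<lambda>k. pure_tensor R P L (b k) (d k Y)) K"
      using b dL Y by (intro TL.finprod_cong') auto
    then show "X = Y" using d(4) X Y by simp
  qed
  moreover have "X \<in> ?f ` carrier (tensor R P L)"
    if X: "X \<in> carrier (tensor R P M)" and U: "U \<in> carrier (tensor R P L)"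
      and V: "V \<in> carrier (tensor R P L)" and eq: "X \<otimes>\<^bsub>tensor R P M\<^esub> ?f U = ?f V" for X U V
  proof -
    \<comment> \<open>Applying the k-th coordinate to the given equation produces an equation of the
      same shape in M, to which subtractivity of the image of f applies.\<close>
    have "\<exists>w\<in>carrier L. e k X = f w" if k: "k \<in> K" for k
    proof -
      have "e k X \<oplus>\<^bsub>M\<^esub> f (d k U) = f (d k V)"
        using hom_mult[OF e(1)[OF k] X hom_in_carrier[OF Tf(1) U]] eq nat[OF k U] nat[OF k V] by simp
      then show ?thesis using sub[OF eM[OF k X] dL[OF k U] dL[OF k V]] by auto
    qed
    then obtain w where w: "\<And>k. k \<in> K \<Longrightarrow> w k \<in> carrier L" "\<And>k. k \<in> K \<Longrightarrow> e k X = f (w k)"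
      by metis
    \<comment> \<open>The coordinatewise preimages are reassembled by the reconstruction formula; f
      maps the result to the element with the coordinates of X, which is X.\<close>
    let ?W = "finprod (tensor R P L) (\<lambda>k. pure_tensor R P L (b k) (w k)) K"
    have bw: "(\<lambda>k. pure_tensor R P L (b k) (w k)) \<in> K \<rightarrow> carrier (tensor R P L)"
      using b w by auto
    have "?f ?W = finprod (tensor R P M) (\<lambda>k. ?f (pure_tensor R P L (b k) (w k))) K"
      by (rule hom_finprod[OF TL.comm_monoid_axioms TM.comm_monoid_axioms Tf(1,2) K bw])
    also have "\<dots> = finprod (tensor R P M) (\<lambda>k. pure_tensor R P M (b k) (e k X)) K"
    proof (rule TM.finprod_cong')
      fix k assume k: "k \<in> K"
      have bk: "b k \<in> carrier P" using b k by auto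
      show "?f (pure_tensor R P L (b k) (w k)) = pure_tensor R P M (b k) (e k X)"
        using Tf(3)[OF bk w(1)[OF k]] w(2)[OF k] by simp
    next
      show "(\<lambda>k. pure_tensor R P M (b k) (e k X)) \<in> K \<rightarrow> carrier (tensor R P M)"
      proof (rule Pi_I)
        fix k assume k: "k \<in> K"
        show "pure_tensor R P M (b k) (e k X) \<in> carrier (tensor R P M)"
          by (rule PM.pure_tensor_closed[OF _ eM[OF k X]]) (use b k in auto)
      qed
    qed simp
    also have "\<dots> = X" by (rule e(4)[OF X])
    finally have "X = ?f ?W" by simp
    then show ?thesis using TL.finprod_closed[OF bw] by (rule image_eqI)
  qed
  ultimately show ?thesis unfolding normal_mono_def by blast
qed

section \<open>Dual bases of projective semimodules\<close>

lemma finsum_free_semimod_apply: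
  assumes "semiring R" "finite K" "u \<in> K \<rightarrow> carrier (free_semimod R X)" "x \<in> X"
  shows "finsum (free_semimod R X) u K x = finsum R (\<lambda>k. u k x) K"
proof -
  interpret semiring R by fact
  interpret F: right_semimodule R "free_semimod R X"
    by (rule free_semimod_right_semimodule) fact
  show ?thesis
    using assms(2,3)
  proof (induction K)
    case empty
    have "finsum (free_semimod R X) u {} = (\<lambda>_. \<zero>\<^bsub>R\<^esub>)" by (simp, simp add: free_semimod_def)
    then show ?case by simp
  next
    case (insert k K)
    have "finsum R (\<lambda>k. u k x) (insert k K) = u k x \<oplus>\<^bsub>R\<^esub> finsum R (\<lambda>k. u k x) K"
      using insert assms(4) free_semimodD(3) by (intro finsum_insert) (fastforce simp: Pi_iff)+
    moreover have "finsum (free_semimod R X) u (insert k K)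
      = u k \<oplus>\<^bsub>free_semimod R X\<^esub> finsum (free_semimod R X) u K"
      using insert by (intro F.finsum_insert) auto
    ultimately show ?case
      using insert by (simp add: free_semimod_def Pi_iff)
  qed
qed

text \<open>Projectivity splits the presenting surjection p from a finite free semimodule by some s.
  The images of the unit vectors under p and the components of s then form a dual basis: x = p (s x)
  expands as the combination of the \<open>p (u k)\<close> with coefficients
  \<open>s x k\<close>.\<close>

lemma projective_normal_mono:
  fixes R :: "('r, 'z) ring_scheme" and P :: "('r, 'p) module"
    and L :: "('r, 'l) module" and M :: "('r, 'm) module"
  assumes "projective R P" "finitely_presented R P"
    and "left_semimodule R L" "left_semimodule R M" "f \<in> lin_hom R L M"
    and "normal_mono (add_monoid L) (add_monoid M) f"
  shows "normal_mono (tensor R P L) (tensor R P M) (tensor_map R P M id f)"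
proof -
  have P: "right_semimodule R P" using assms(1) by (simp add: projective_def)
  interpret P: right_semimodule R P by fact
  have R: "semiring R" by (rule P.semiring_axioms)
  obtain n p where p: "p \<in> lin_hom R (free_semimod R {..<n::nat}) P"
    "p ` carrier (free_semimod R {..<n}) = carrier P"
    using assms(2) unfolding finitely_presented_def by blast
  let ?F = "free_semimod R {..<n}"
  interpret F: right_semimodule R ?F by (rule free_semimod_right_semimodule) fact
  have "hom_lifting R P ?F P p"
    by (rule projective_hom_lifting[OF assms(1) F.right_semimodule_axioms P p])
  \<comment> \<open>The section s is a lift of the identity of P along p.\<close>
  then obtain s where s: "s \<in> lin_hom R P ?F" "\<And>x. x \<in> carrier P \<Longrightarrow> p (s x) = x"
    using id_lin_hom(1)[of R P] unfolding hom_lifting_def by fastforce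
  define u where "u = (\<lambda>(k::nat) j. if j = k then \<one>\<^bsub>R\<^esub> else \<zero>\<^bsub>R\<^esub>)"
  have u: "u k \<in> carrier ?F" if "k < n" for k
    using that by (auto simp: u_def free_semimod_def)
  have expand: "finsum ?F (\<lambda>k. v k \<odot>\<^bsub>?F\<^esub> u k) {..<n} = v" if v: "v \<in> carrier ?F" for v
  proof
    fix j
    have vu: "(\<lambda>k. v k \<odot>\<^bsub>?F\<^esub> u k) \<in> {..<n} \<rightarrow> carrier ?F"
      using u free_semimodD(3)[OF v] by auto
    show "finsum ?F (\<lambda>k. v k \<odot>\<^bsub>?F\<^esub> u k) {..<n} j = v j"
    proof (cases "j < n")
      case True
      have "finsum ?F (\<lambda>k. v k \<odot>\<^bsub>?F\<^esub> u k) {..<n} j = finsum R (\<lambda>k. (v k \<odot>\<^bsub>?F\<^esub> u k) j) {..<n}"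
        by (rule finsum_free_semimod_apply[OF R _ vu]) (use True in auto)
      also have "\<dots> = finsum R (\<lambda>k. if j = k then v k else \<zero>\<^bsub>R\<^esub>) {..<n}"
        by (rule P.R.finsum_cong')
          (use free_semimodD(3)[OF v] in \<open>auto simp: u_def free_semimod_def\<close>)
      also have "\<dots> = v j"
        by (rule P.R.finsum_singleton) (use True free_semimodD(3)[OF v] in auto)
      finally show ?thesis .
    next
      \<comment> \<open>Vectors are functions on all natural numbers extended by zero, so both sides
        vanish beyond n.\<close>
      case False
      then show ?thesis
        using v F.finsum_closed[OF vu] by (auto simp: free_semimod_def)
    qed
  qed
  have p_finsum: "p (finsum ?F h {..<n}) = finsum P (\<lambda>k. p (h k)) {..<n}"
    if "h \<in> {..<n} \<rightarrow> carrier ?F" for h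
  proof -
    have "p \<in> hom (add_monoid ?F) (add_monoid P)" using p(1) by (simp add: lin_hom_def)
    from hom_finprod[OF F.add.comm_monoid_axioms P.add.comm_monoid_axioms this, of "{..<n}" h]
    show ?thesis
      using that lin_hom_zero[OF p(1) F.presemimodule_axioms P.presemimodule_axioms]
      by (simp add: finsum_def)
  qed
  note s' = lin_homD[OF s(1)]
  show ?thesis
  proof (rule dual_basis_normal_mono[OF P assms(3-6), where K = "{..<n}" and b = "\<lambda>k. p (u k)"
        and \<xi> = "\<lambda>k x. s x k"])
    show "(\<lambda>k. p (u k)) \<in> {..<n} \<rightarrow> carrier P"
      using u lin_homD(1)[OF p(1)] by auto
    fix k x assume k: "k \<in> {..<n}" and x: "x \<in> carrier P"
    show "s x k \<in> carrier R" by (rule free_semimodD(3)[OF s'(1)[OF x] k])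
    show "s (x \<oplus>\<^bsub>P\<^esub> y) k = s x k \<oplus>\<^bsub>R\<^esub> s y k" if "y \<in> carrier P" for y
      using s'(2)[OF x that] by (simp add: free_semimod_def)
    show "s (a \<odot>\<^bsub>P\<^esub> x) k = s x k \<otimes>\<^bsub>R\<^esub> a" if "a \<in> carrier R" for a
      using s'(3)[OF that x] by (simp add: free_semimod_def)
  next
    fix x assume x: "x \<in> carrier P"
    have sx: "s x k \<in> carrier R" if "k < n" for k
      using free_semimodD(3)[OF s'(1)[OF x]] that by simp
    have "x = p (finsum ?F (\<lambda>k. s x k \<odot>\<^bsub>?F\<^esub> u k) {..<n})"
      using expand[OF s'(1)[OF x]] s(2)[OF x] by simp
    also have "\<dots> = finsum P (\<lambda>k. p (s x k \<odot>\<^bsub>?F\<^esub> u k)) {..<n}"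
      by (rule p_finsum) (use sx u in auto)
    also have "\<dots> = finsum P (\<lambda>k. s x k \<odot>\<^bsub>P\<^esub> p (u k)) {..<n}"
      by (rule P.finsum_cong') (use sx u lin_homD[OF p(1)] in auto)
    finally show "finsum P (\<lambda>k. s x k \<odot>\<^bsub>P\<^esub> p (u k)) {..<n} = x" by simp
  qed simp
qed


section \<open>Directed limits\<close>

text \<open>A cocone that is jointly surjective and identifies elements only when some later stage
  already does: this is what the tensor arguments need of a directed limit. It frees them from the
  quotient construction and from the isomorphism onto F.\<close>

locale directed_limit = directed_system R I r M \<phi> + F: right_semimodule R F
  for R (structure) and I :: "'i set" and r and M :: "'i \<Rightarrow> ('a, 'c) module" and \<phi>
    and F :: "('a, 'f) module" +
  fixes \<gamma> :: "'i \<Rightarrow> 'c \<Rightarrow> 'f"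
  assumes cocone_lin: "i \<in> I \<Longrightarrow> \<gamma> i \<in> lin_hom R (M i) F"
    and cocone_trans: "\<lbrakk>(i, j) \<in> r; x \<in> carrier (M i)\<rbrakk> \<Longrightarrow> \<gamma> j (\<phi> i j x) = \<gamma> i x"
    and cocone_surj: "z \<in> carrier F \<Longrightarrow> \<exists>i\<in>I. \<exists>x\<in>carrier (M i). \<gamma> i x = z"
    and cocone_eqD: "\<lbrakk>i \<in> I; j \<in> I; x \<in> carrier (M i); y \<in> carrier (M j); \<gamma> i x = \<gamma> j y\<rbrakk>
      \<Longrightarrow> \<exists>k. (i, k) \<in> r \<and> (j, k) \<in> r \<and> \<phi> i k x = \<phi> j k y"
begin

section \<open>Tensors over the limit and their representatives at the stages\<close>

lemma tensor_pair_stage: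
  "\<lbrakk>left_semimodule R N; i \<in> I\<rbrakk> \<Longrightarrow> tensor_pair R (M i) N"
  "left_semimodule R N \<Longrightarrow> tensor_pair R F N"
  using semimod F.right_semimodule_axioms by (auto intro: tensor_pair.intro)

lemma tensor_map_cocone:
  assumes N: "left_semimodule R N" and ij: "(i, j) \<in> r" and X: "X \<in> carrier (tensor R (M i) N)"
  shows "tensor_map R F N (\<gamma> j) id (tensor_map R (M j) N (\<phi> i j) id X) = tensor_map R F N (\<gamma> i) id X"
proof -
  have i: "i \<in> I" and j: "j \<in> I" using index_mem[OF ij] .
  note iN = tensor_pair_stage(1)[OF N i]
  note FN = tensor_pair_stage(2)[OF N]
  obtain A where A: "X = tensor_cong R (M i) N `` {A}" "set_mset A \<subseteq> carrier (M i) \<times> carrier N"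
    using X by (auto simp: tensor_pair.tensor_carrier[OF iN])
  have "tensor_map R F N (\<gamma> j) id (tensor_map R (M j) N (\<phi> i j) id X)
    = tensor_map R F N (\<lambda>x. \<gamma> j (\<phi> i j x)) id X"
    using tensor_map_comp[OF iN tensor_pair_stage(1)[OF N j] FN trans_lin[OF ij]
          id_lin_hom(1) cocone_lin[OF j] id_lin_hom(1) X] by (simp add: id_def)
  also have "\<dots> = tensor_cong R F N `` {image_mset (map_prod (\<lambda>x. \<gamma> j (\<phi> i j x)) id) A}"
    unfolding A(1)
    by (rule tensor_map_cls[OF iN FN lin_hom_comp[OF trans_lin[OF ij] cocone_lin[OF j]]
          id_lin_hom(1) A(2)])
  \<comment> \<open>The cocone identity is only available on the carrier of \<open>M i\<close>, so
    the two functions are compared on a representing multiset.\<close>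
  also have "image_mset (map_prod (\<lambda>x. \<gamma> j (\<phi> i j x)) id) A = image_mset (map_prod (\<gamma> i) id) A"
    by (rule image_mset_cong) (use A(2) cocone_trans[OF ij] in auto)
  also have "tensor_cong R F N `` {\<dots>} = tensor_map R F N (\<gamma> i) id X"
    unfolding A(1)
    by (rule tensor_map_cls[OF iN FN cocone_lin[OF i] id_lin_hom(1) A(2), symmetric])
  finally show ?thesis .
qed

text \<open>A tensor is a finite sum of pure tensors, and the left factor of each comes from some
  stage; directedness merges these stages. Starting above a prescribed i makes it possible to bring
  several tensors to a common stage by successive applications.\<close>

lemma tensor_stage:
  assumes N: "left_semimodule R N" and X: "X \<in> carrier (tensor R F N)" and i: "i \<in> I"
  obtains k X' where "(i, k) \<in> r" "X' \<in> carrier (tensor R (M k) N)"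
    "X = tensor_map R F N (\<gamma> k) id X'"
proof -
  note FN = tensor_pair_stage(2)[OF N]
  have "\<exists>k X'. (i, k) \<in> r \<and> X' \<in> carrier (tensor R (M k) N) \<and> X = tensor_map R F N (\<gamma> k) id X'"
    using X
  proof (induction rule: tensor_pair.tensor_induct[OF FN, consumes 1, case_names one pure])
    case one
    note iN = tensor_pair_stage(1)[OF N i]
    show ?case
      using index_refl[OF i] tensor_map_hom(2)[OF iN FN cocone_lin[OF i] id_lin_hom(1)]
        comm_monoid.axioms(1)[OF tensor_pair.tensor_comm_monoid[OF iN]] monoid.one_closed
      by metis
  next
    case (pure y n Y)
    then obtain k Y' where k: "(i, k) \<in> r" "Y' \<in> carrier (tensor R (M k) N)"
      "Y = tensor_map R F N (\<gamma> k) id Y'" by blast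
    obtain j x where j: "j \<in> I" "x \<in> carrier (M j)" "\<gamma> j x = y"
      using cocone_surj[OF pure(1)] by blast
    \<comment> \<open>A common stage l for the new summand and for the sum built so far.\<close>
    obtain l where l: "l \<in> I" "(k, l) \<in> r" "(j, l) \<in> r"
      using index_ub[OF index_mem(2)[OF k(1)] j(1)] .
    note lN = tensor_pair_stage(1)[OF N l(1)]
    note kN = tensor_pair_stage(1)[OF N index_mem(2)[OF k(1)]]
    note h = tensor_map_hom[OF lN FN cocone_lin[OF l(1)] id_lin_hom(1)]
    let ?x = "\<phi> j l x" and ?Y = "tensor_map R (M l) N (\<phi> k l) id Y'"
    have x: "?x \<in> carrier (M l)" by (rule trans_homD(1)[OF l(3) j(2)])
    have Y: "?Y \<in> carrier (tensor R (M l) N)"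
      by (rule hom_in_carrier[OF tensor_map_hom(1)[OF kN lN trans_lin[OF l(2)] id_lin_hom(1)] k(2)])
    have xn: "pure_tensor R (M l) N ?x n \<in> carrier (tensor R (M l) N)"
      using tensor_pair.pure_tensor_closed[OF lN x pure(2)] .
    have "tensor_map R F N (\<gamma> l) id (pure_tensor R (M l) N ?x n \<otimes>\<^bsub>tensor R (M l) N\<^esub> ?Y)
      = pure_tensor R F N y n \<otimes>\<^bsub>tensor R F N\<^esub> Y"
      using hom_mult[OF h(1) xn Y] h(3)[OF x pure(2)] tensor_map_cocone[OF N l(2) k(2)]
        cocone_trans[OF l(3) j(2)] j(3) k(3) by simp
    moreover have "pure_tensor R (M l) N ?x n \<otimes>\<^bsub>tensor R (M l) N\<^esub> ?Y \<in> carrier (tensor R (M l) N)"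
      using monoid.m_closed[OF comm_monoid.axioms(1)[OF tensor_pair.tensor_comm_monoid[OF lN]] xn Y] .
    ultimately show ?case using index_trans[OF k(1) l(2)] by metis
  qed
  then show thesis using that by blast
qed

text \<open>A derivation of the equality over F is lifted to pairs whose left entries are tagged by
  a stage. Every rule becomes valid from some stage on, and directedness combines the finitely many
  stages that a derivation requires.\<close>

lemma tensor_eq_stage:
  fixes N :: "('a, 'g) module"
  assumes N: "left_semimodule R N" and i: "i \<in> I"
    and X: "X \<in> carrier (tensor R (M i) N)" and Y: "Y \<in> carrier (tensor R (M i) N)"
    and eq: "tensor_map R F N (\<gamma> i) id X = tensor_map R F N (\<gamma> i) id Y"
  obtains k where "(i, k) \<in> r"
    "tensor_map R (M k) N (\<phi> i k) id X = tensor_map R (M k) N (\<phi> i k) id Y"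
proof -
  interpret N: left_semimodule R N by fact
  note iN = tensor_pair_stage(1)[OF N i]
  note FN = tensor_pair_stage(2)[OF N]
  obtain A where A: "X = tensor_cong R (M i) N `` {A}" "set_mset A \<subseteq> carrier (M i) \<times> carrier N"
    using X by (auto simp: tensor_pair.tensor_carrier[OF iN])
  obtain B where B: "Y = tensor_cong R (M i) N `` {B}" "set_mset B \<subseteq> carrier (M i) \<times> carrier N"
    using Y by (auto simp: tensor_pair.tensor_carrier[OF iN])
  \<comment> \<open>The surjection to lift along: D is the disjoint union of the stages, paired with
    N, and h maps it onto the pairs over F.\<close>
  define D where "D = (SIGMA i:I. carrier (M i)) \<times> carrier N"
  define h where "h = (\<lambda>((i, x), n :: 'g). (\<gamma> i x, n))"
  define push where "push = (\<lambda>k ((i, x), n :: 'g). (\<phi> i k x, n))"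
  \<comment> \<open>Being congruent at every stage above some k, and not merely at k, lets two such
    facts be used together at a common upper bound. It also avoids stages where \<open>push\<close>
    would apply a map \<open>\<phi> i j\<close> with j not above i.\<close>
  define \<rho> where "\<rho> = (\<lambda>A B. \<exists>k\<in>I. \<forall>j. (k, j) \<in> r \<longrightarrow>
    (image_mset (push j) A, image_mset (push j) B) \<in> tensor_cong R (M j) N)"
  define A' where "A' = image_mset (\<lambda>(x, n). ((i, x), n)) A"
  define B' where "B' = image_mset (\<lambda>(x, n). ((i, x), n)) B"
  have Z: "\<zero>\<^bsub>M j\<^esub> \<in> carrier (M j)" if "j \<in> I" for j
    using semimod[OF that] by (meson abelian_monoid.zero_closed presemimodule_def right_semimodule_def)
  have hA': "image_mset h A' = image_mset (map_prod (\<gamma> i) id) A" "image_mset h B' = image_mset (map_prod (\<gamma> i) id) B"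
    by (simp_all add: A'_def B'_def h_def multiset.map_comp o_def case_prod_unfold map_prod_def)
  have "image_mset (map_prod (\<gamma> i) id) A \<in> {A. set_mset A \<subseteq> carrier F \<times> carrier N}"
    "image_mset (map_prod (\<gamma> i) id) B \<in> {A. set_mset A \<subseteq> carrier F \<times> carrier N}"
    using A(2) B(2) lin_homD(1)[OF cocone_lin[OF i]] by auto
  then have AB': "(image_mset h A', image_mset h B') \<in> tensor_cong R F N"
    using eq unfolding hA' A(1) B(1) tensor_map_cls[OF iN FN cocone_lin[OF i] id_lin_hom(1) A(2)]
      tensor_map_cls[OF iN FN cocone_lin[OF i] id_lin_hom(1) B(2)]
    by (simp add: tensor_pair.cls_eq_iff[OF FN] del: set_image_mset)
  have AD: "set_mset A' \<subseteq> D" "set_mset B' \<subseteq> D"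
    using A(2) B(2) i by (auto simp: A'_def B'_def D_def)
  have "\<rho> A' B'"
  proof (rule tensor_cong_lift[where h = h and D = D and \<rho> = \<rho> and R = R and F = F and N = N])
    show "carrier F \<times> carrier N \<subseteq> h ` D"
    proof clarify
      fix y n assume y: "y \<in> carrier F" and n: "n \<in> carrier N"
      obtain i x where "i \<in> I" "x \<in> carrier (M i)" "\<gamma> i x = y" using cocone_surj[OF y] by blast
      then show "(y, n) \<in> h ` D"
        using n by (intro image_eqI[of _ _ "((i, x), n)"]) (auto simp: h_def D_def)
    qed
    show "\<rho> {#} {#}"
      unfolding \<rho>_def using i by (intro bexI[of _ i]) (auto intro: tensor_cong.refl)
    show "\<rho> B A" if "\<rho> A B" for A B using that by (auto simp: \<rho>_def intro: tensor_cong.sym)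
  next
    fix A B C assume "\<rho> A B" "\<rho> B C"
    then obtain k k' where k: "k \<in> I" "k' \<in> I"
      "\<And>j. (k, j) \<in> r \<Longrightarrow> (image_mset (push j) A, image_mset (push j) B) \<in> tensor_cong R (M j) N"
      "\<And>j. (k', j) \<in> r \<Longrightarrow> (image_mset (push j) B, image_mset (push j) C) \<in> tensor_cong R (M j) N"
      unfolding \<rho>_def by blast
    obtain l where l: "l \<in> I" "(k, l) \<in> r" "(k', l) \<in> r" using index_ub[OF k(1,2)] .
    show "\<rho> A C" unfolding \<rho>_def
      using l(1) tensor_cong.trans[OF k(3) k(4)] index_trans[OF l(2)] index_trans[OF l(3)] by blast
  next
    fix A B A' B' assume "\<rho> A B" "\<rho> A' B'"
    then obtain k k' where k: "k \<in> I" "k' \<in> I"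
      "\<And>j. (k, j) \<in> r \<Longrightarrow> (image_mset (push j) A, image_mset (push j) B) \<in> tensor_cong R (M j) N"
      "\<And>j. (k', j) \<in> r \<Longrightarrow> (image_mset (push j) A', image_mset (push j) B') \<in> tensor_cong R (M j) N"
      unfolding \<rho>_def by blast
    obtain l where l: "l \<in> I" "(k, l) \<in> r" "(k', l) \<in> r" using index_ub[OF k(1,2)] .
    show "\<rho> (A + A') (B + B')" unfolding \<rho>_def image_mset_union
      using l(1) tensor_cong.add[OF k(3) k(4)] index_trans[OF l(2)] index_trans[OF l(3)] by blast
  next
    fix p q assume pq: "p \<in> D" "q \<in> D" "h p = h q"
    obtain i x m where p: "p = ((i, x), m)" by (metis prod.exhaust)
    obtain j y n where q: "q = ((j, y), n)" by (metis prod.exhaust)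
    have *: "i \<in> I" "j \<in> I" "x \<in> carrier (M i)" "y \<in> carrier (M j)" "\<gamma> i x = \<gamma> j y" "m = n" "n \<in> carrier N"
      using pq by (auto simp: p q D_def h_def)
    \<comment> \<open>Two representatives of one element of F coincide at a later stage k, hence at
      all stages above k.\<close>
    from cocone_eqD[OF *(1-5)] obtain k where k: "(i, k) \<in> r" "(j, k) \<in> r" "\<phi> i k x = \<phi> j k y" by blast
    have "(image_mset (push l) {#p#}, image_mset (push l) {#q#}) \<in> tensor_cong R (M l) N"
      if l: "(k, l) \<in> r" for l
    proof -
      have "\<phi> i l x = \<phi> j l y"
        using trans_comp[OF k(1) l *(3)] trans_comp[OF k(2) l *(4)] k(3) by simp
      moreover have "\<phi> i l x \<in> carrier (M l)"
        using trans_homD(1)[OF index_trans[OF k(1) l] *(3)] .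
      ultimately show ?thesis
        using * by (auto simp: p q push_def intro!: tensor_cong.refl)
    qed
    then show "\<rho> {#p#} {#q#}" unfolding \<rho>_def using index_mem[OF k(1)] by blast
  next
    fix x y n assume x: "x \<in> carrier F" and y: "y \<in> carrier F" and n: "n \<in> carrier N"
    obtain i x' where i: "i \<in> I" "x' \<in> carrier (M i)" "\<gamma> i x' = x" using cocone_surj[OF x] by blast
    obtain j y' where j: "j \<in> I" "y' \<in> carrier (M j)" "\<gamma> j y' = y" using cocone_surj[OF y] by blast
    \<comment> \<open>Lifts of x and y must lie in the same stage before their sum can be formed
      upstairs.\<close>
    obtain k where k: "k \<in> I" "(i, k) \<in> r" "(j, k) \<in> r" using index_ub[OF i(1) j(1)] .
    let ?x = "\<phi> i k x'" and ?y = "\<phi> j k y'"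
    have xy: "?x \<in> carrier (M k)" "?y \<in> carrier (M k)"
      using trans_homD(1) k i j by blast+
    then have s: "?x \<oplus>\<^bsub>M k\<^esub> ?y \<in> carrier (M k)"
      using semimod[OF k(1)] by (meson abelian_monoid.a_closed presemimodule_def right_semimodule_def)
    have g: "\<gamma> k ?x = x" "\<gamma> k ?y = y" "\<gamma> k (?x \<oplus>\<^bsub>M k\<^esub> ?y) = x \<oplus>\<^bsub>F\<^esub> y"
      using cocone_trans k i j lin_homD(2)[OF cocone_lin[OF k(1)] xy] by auto
    have "\<rho> {#((k, ?x \<oplus>\<^bsub>M k\<^esub> ?y), n)#} {#((k, ?x), n), ((k, ?y), n)#}"
      unfolding \<rho>_def using k(1) n xy
      by (intro bexI[of _ k]) (auto simp: push_def trans_homD intro!: tensor_cong.add_left)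
    then show "\<exists>p\<in>D. \<exists>q\<in>D. \<exists>s\<in>D. h p = (x \<oplus>\<^bsub>F\<^esub> y, n) \<and> h q = (x, n) \<and> h s = (y, n) \<and> \<rho> {#p#} {#q, s#}"
      using xy s n g k(1)
      by (intro bexI[of _ "((k, ?x \<oplus>\<^bsub>M k\<^esub> ?y), n)"] bexI[of _ "((k, ?x), n)"] bexI[of _ "((k, ?y), n)"])
        (auto simp: h_def D_def)
  next
    fix n assume n: "n \<in> carrier N"
    have "\<rho> {#((i, \<zero>\<^bsub>M i\<^esub>), n)#} {#}"
      unfolding \<rho>_def using i n
      by (intro bexI[of _ i]) (auto simp: push_def trans_zero intro!: tensor_cong.zero_left)
    then show "\<exists>p\<in>D. h p = (\<zero>\<^bsub>F\<^esub>, n) \<and> \<rho> {#p#} {#}"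
      using i n Z lin_hom_zero[OF cocone_lin[OF i]] semimod[OF i] F.presemimodule_axioms
      by (intro bexI[of _ "((i, \<zero>\<^bsub>M i\<^esub>), n)"]) (auto simp: h_def D_def right_semimodule_def)
  next
    fix x m n assume x: "x \<in> carrier F" and m: "m \<in> carrier N" and n: "n \<in> carrier N"
    obtain i x' where i: "i \<in> I" "x' \<in> carrier (M i)" "\<gamma> i x' = x" using cocone_surj[OF x] by blast
    have "\<rho> {#((i, x'), m \<oplus>\<^bsub>N\<^esub> n)#} {#((i, x'), m), ((i, x'), n)#}"
      unfolding \<rho>_def using i m n
      by (intro bexI[of _ i]) (auto simp: push_def trans_homD intro!: tensor_cong.add_right)
    then show "\<exists>p\<in>D. \<exists>q\<in>D. \<exists>s\<in>D. h p = (x, m \<oplus>\<^bsub>N\<^esub> n) \<and> h q = (x, m) \<and> h s = (x, n) \<and> \<rho> {#p#} {#q, s#}"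
      using i m n
      by (intro bexI[of _ "((i, x'), m \<oplus>\<^bsub>N\<^esub> n)"] bexI[of _ "((i, x'), m)"] bexI[of _ "((i, x'), n)"])
        (auto simp: h_def D_def)
  next
    fix x assume x: "x \<in> carrier F"
    obtain i x' where i: "i \<in> I" "x' \<in> carrier (M i)" "\<gamma> i x' = x" using cocone_surj[OF x] by blast
    have "\<rho> {#((i, x'), \<zero>\<^bsub>N\<^esub>)#} {#}"
      unfolding \<rho>_def using i
      by (intro bexI[of _ i]) (auto simp: push_def trans_homD intro!: tensor_cong.zero_right)
    then show "\<exists>p\<in>D. h p = (x, \<zero>\<^bsub>N\<^esub>) \<and> \<rho> {#p#} {#}"
      using i by (intro bexI[of _ "((i, x'), \<zero>\<^bsub>N\<^esub>)"]) (auto simp: h_def D_def)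
  next
    fix a x n assume a: "a \<in> carrier R" and x: "x \<in> carrier F" and n: "n \<in> carrier N"
    obtain i x' where i: "i \<in> I" "x' \<in> carrier (M i)" "\<gamma> i x' = x" using cocone_surj[OF x] by blast
    have ax: "a \<odot>\<^bsub>M i\<^esub> x' \<in> carrier (M i)"
      using semimod[OF i(1)] a i(2) by (meson presemimodule.smult_closed right_semimodule_def)
    have "\<rho> {#((i, a \<odot>\<^bsub>M i\<^esub> x'), n)#} {#((i, x'), a \<odot>\<^bsub>N\<^esub> n)#}"
      unfolding \<rho>_def using i n a
      by (intro bexI[of _ i]) (auto simp: push_def trans_homD intro!: tensor_cong.balance)
    then show "\<exists>p\<in>D. \<exists>q\<in>D. h p = (a \<odot>\<^bsub>F\<^esub> x, n) \<and> h q = (x, a \<odot>\<^bsub>N\<^esub> n) \<and> \<rho> {#p#} {#q#}"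
      using i n a ax lin_homD(3)[OF cocone_lin[OF i(1)] a i(2)]
      by (intro bexI[of _ "((i, a \<odot>\<^bsub>M i\<^esub> x'), n)"] bexI[of _ "((i, x'), a \<odot>\<^bsub>N\<^esub> n)"])
        (auto simp: h_def D_def)
  qed (fact AD AB')+
  then obtain k0 where k0: "k0 \<in> I"
    "\<And>j. (k0, j) \<in> r \<Longrightarrow> (image_mset (push j) A', image_mset (push j) B') \<in> tensor_cong R (M j) N"
    unfolding \<rho>_def by blast
  \<comment> \<open>The relation holds above k0, while the transition map starts at i; k lies above
    both.\<close>
  obtain k where k: "k \<in> I" "(k0, k) \<in> r" "(i, k) \<in> r" using index_ub[OF k0(1) i] .
  note kN = tensor_pair_stage(1)[OF N k(1)]
  have pushA: "image_mset (push k) A' = image_mset (map_prod (\<phi> i k) id) A"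
    "image_mset (push k) B' = image_mset (map_prod (\<phi> i k) id) B"
    by (simp_all add: A'_def B'_def push_def multiset.map_comp o_def case_prod_unfold map_prod_def)
  have "tensor_map R (M k) N (\<phi> i k) id X = tensor_map R (M k) N (\<phi> i k) id Y"
    unfolding A(1) B(1) tensor_map_cls[OF iN kN trans_lin[OF k(3)] id_lin_hom(1) A(2)]
      tensor_map_cls[OF iN kN trans_lin[OF k(3)] id_lin_hom(1) B(2)]
    using tensor_pair.cls_eq[OF kN k0(2)[OF k(2)]] by (simp add: pushA)
  then show thesis using that k(3) by blast
qed

text \<open>Injectivity and subtractivity both assume one equation between finitely many tensors.
  The tensors are represented at a common stage, the equation already holds at a later one,
  normality is applied there, and the conclusion is mapped back to the limit.\<close>

lemma tensor_normal_mono: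
  fixes L :: "('a, 'l) module" and N :: "('a, 'n) module"
  assumes L: "left_semimodule R L" and N: "left_semimodule R N" and f: "f \<in> lin_hom R L N"
    and nm: "\<And>i. i \<in> I \<Longrightarrow>
      normal_mono (tensor R (M i) L) (tensor R (M i) N) (tensor_map R (M i) N id f)"
  shows "normal_mono (tensor R F L) (tensor R F N) (tensor_map R F N id f)"
proof -
  note FL = tensor_pair_stage(2)[OF L]
  note FN = tensor_pair_stage(2)[OF N]
  note iL = tensor_pair_stage(1)[OF L]
  note iN = tensor_pair_stage(1)[OF N]
  let ?f = "\<lambda>i. tensor_map R (M i) N id f"
  let ?cL = "\<lambda>i. tensor_map R F L (\<gamma> i) id" and ?cN = "\<lambda>i. tensor_map R F N (\<gamma> i) id"
  let ?tL = "\<lambda>i j. tensor_map R (M j) L (\<phi> i j) id" and ?tN = "\<lambda>i j. tensor_map R (M j) N (\<phi> i j) id"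
  have fi: "?f i \<in> hom (tensor R (M i) L) (tensor R (M i) N)" if "i \<in> I" for i
    by (rule tensor_map_hom(1)[OF iL[OF that] iN[OF that] id_lin_hom(1) f])
  have cL: "?cL i \<in> hom (tensor R (M i) L) (tensor R F L)" if "i \<in> I" for i
    by (rule tensor_map_hom(1)[OF iL[OF that] FL cocone_lin[OF that] id_lin_hom(1)])
  have cN: "?cN i \<in> hom (tensor R (M i) N) (tensor R F N)" if "i \<in> I" for i
    by (rule tensor_map_hom(1)[OF iN[OF that] FN cocone_lin[OF that] id_lin_hom(1)])
  have tL: "?tL i j \<in> hom (tensor R (M i) L) (tensor R (M j) L)" if "(i, j) \<in> r" for i j
    by (rule tensor_map_hom(1)[OF iL iL trans_lin[OF that] id_lin_hom(1)])
      (use index_mem[OF that] in auto)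
  have tN: "?tN i j \<in> hom (tensor R (M i) N) (tensor R (M j) N)" if "(i, j) \<in> r" for i j
    by (rule tensor_map_hom(1)[OF iN iN trans_lin[OF that] id_lin_hom(1)])
      (use index_mem[OF that] in auto)
  have comc: "?cN i (?f i X) = tensor_map R F N id f (?cL i X)"
    if "i \<in> I" "X \<in> carrier (tensor R (M i) L)" for i X
    by (rule tensor_map_commute[OF iL[OF that(1)] iN[OF that(1)] FL FN cocone_lin[OF that(1)] f that(2)])
  have comt: "?tN i j (?f i X) = ?f j (?tL i j X)"
    if ij: "(i, j) \<in> r" and X: "X \<in> carrier (tensor R (M i) L)" for i j X
    by (rule tensor_map_commute[OF iL iN iL iN trans_lin[OF ij] f X])
      (use index_mem[OF ij] in auto)
  obtain i0 where i0: "i0 \<in> I" using directed by (auto simp: directed_set_def)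
  have "inj_on (tensor_map R F N id f) (carrier (tensor R F L))"
  proof (rule inj_onI)
    fix X Y assume X: "X \<in> carrier (tensor R F L)" and Y: "Y \<in> carrier (tensor R F L)"
      and eq: "tensor_map R F N id f X = tensor_map R F N id f Y"
    obtain i X1 where i: "(i0, i) \<in> r" "X1 \<in> carrier (tensor R (M i) L)" "X = ?cL i X1"
      by (rule tensor_stage[OF L X i0])
    \<comment> \<open>Asking for a stage above i places Y at a stage to which the representative of
      X can be moved.\<close>
    obtain j Y' where j: "(i, j) \<in> r" "Y' \<in> carrier (tensor R (M j) L)" "Y = ?cL j Y'"
      by (rule tensor_stage[OF L Y index_mem(2)[OF i(1)]])
    have jI: "j \<in> I" by (rule index_mem(2)[OF j(1)])
    let ?X = "?tL i j X1"
    have X': "?X \<in> carrier (tensor R (M j) L)" by (rule hom_in_carrier[OF tL[OF j(1)] i(2)])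
    have Xeq: "X = ?cL j ?X" using tensor_map_cocone[OF L j(1) i(2)] i(3) by simp
    have "?cN j (?f j ?X) = ?cN j (?f j Y')"
      using comc[OF jI X'] comc[OF jI j(2)] Xeq j(3) eq by simp
    from tensor_eq_stage[OF N jI hom_in_carrier[OF fi[OF jI] X'] hom_in_carrier[OF fi[OF jI] j(2)] this]
    obtain k where k: "(j, k) \<in> r" "?tN j k (?f j ?X) = ?tN j k (?f j Y')" .
    have kI: "k \<in> I" by (rule index_mem(2)[OF k(1)])
    have "?f k (?tL j k ?X) = ?f k (?tL j k Y')"
      using comt[OF k(1) X'] comt[OF k(1) j(2)] k(2) by simp
    moreover have "inj_on (?f k) (carrier (tensor R (M k) L))"
      using nm[OF kI] unfolding normal_mono_def by blast
    ultimately have "?tL j k ?X = ?tL j k Y'"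
      using hom_in_carrier[OF tL[OF k(1)]] X' j(2) by (auto dest: inj_onD)
    then show "X = Y"
      using tensor_map_cocone[OF L k(1) X'] tensor_map_cocone[OF L k(1) j(2)] Xeq j(3) by simp
  qed
  moreover have "X \<in> tensor_map R F N id f ` carrier (tensor R F L)"
    if X: "X \<in> carrier (tensor R F N)" and U: "U \<in> carrier (tensor R F L)"
      and V: "V \<in> carrier (tensor R F L)"
      and eq: "X \<otimes>\<^bsub>tensor R F N\<^esub> tensor_map R F N id f U = tensor_map R F N id f V" for X U V
  proof -
    obtain i X1 where i: "(i0, i) \<in> r" "X1 \<in> carrier (tensor R (M i) N)" "X = ?cN i X1"
      by (rule tensor_stage[OF N X i0])
    obtain j U1 where j: "(i, j) \<in> r" "U1 \<in> carrier (tensor R (M j) L)" "U = ?cL j U1"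
      by (rule tensor_stage[OF L U index_mem(2)[OF i(1)]])
    obtain k V' where k: "(j, k) \<in> r" "V' \<in> carrier (tensor R (M k) L)" "V = ?cL k V'"
      by (rule tensor_stage[OF L V index_mem(2)[OF j(1)]])
    have kI: "k \<in> I" by (rule index_mem(2)[OF k(1)])
    have ik: "(i, k) \<in> r" by (rule index_trans[OF j(1) k(1)])
    let ?X = "?tN i k X1" and ?U = "?tL j k U1"
    have X': "?X \<in> carrier (tensor R (M k) N)" by (rule hom_in_carrier[OF tN[OF ik] i(2)])
    have U': "?U \<in> carrier (tensor R (M k) L)" by (rule hom_in_carrier[OF tL[OF k(1)] j(2)])
    have fU: "?f k ?U \<in> carrier (tensor R (M k) N)" by (rule hom_in_carrier[OF fi[OF kI] U'])
    have fV: "?f k V' \<in> carrier (tensor R (M k) N)" by (rule hom_in_carrier[OF fi[OF kI] k(2)])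
    have XU: "?X \<otimes>\<^bsub>tensor R (M k) N\<^esub> ?f k ?U \<in> carrier (tensor R (M k) N)"
      using monoid.m_closed[OF comm_monoid.axioms(1)[OF tensor_pair.tensor_comm_monoid[OF iN[OF kI]]] X' fU] .
    have Xeq: "X = ?cN k ?X" using tensor_map_cocone[OF N ik i(2)] i(3) by simp
    have Ueq: "U = ?cL k ?U" using tensor_map_cocone[OF L k(1) j(2)] j(3) by simp
    \<comment> \<open>The hypothesis on X, U and V becomes an equality of images of two tensors at
      stage k, which is the form that \<open>tensor_eq_stage\<close> accepts.\<close>
    have "?cN k (?X \<otimes>\<^bsub>tensor R (M k) N\<^esub> ?f k ?U) = ?cN k (?f k V')"
      using hom_mult[OF cN[OF kI] X' fU] comc[OF kI U'] comc[OF kI k(2)] Xeq Ueq k(3) eq by simp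
    from tensor_eq_stage[OF N kI XU fV this] obtain l where l: "(k, l) \<in> r"
      "?tN k l (?X \<otimes>\<^bsub>tensor R (M k) N\<^esub> ?f k ?U) = ?tN k l (?f k V')" .
    have lI: "l \<in> I" by (rule index_mem(2)[OF l(1)])
    have "?tN k l ?X \<otimes>\<^bsub>tensor R (M l) N\<^esub> ?f l (?tL k l ?U) = ?f l (?tL k l V')"
      using hom_mult[OF tN[OF l(1)] X' fU] comt[OF l(1) U'] comt[OF l(1) k(2)] l(2) by simp
    then have "?tN k l ?X \<in> ?f l ` carrier (tensor R (M l) L)"
      using nm[OF lI] hom_in_carrier[OF tN[OF l(1)] X'] hom_in_carrier[OF tL[OF l(1)] U']
        hom_in_carrier[OF tL[OF l(1)] k(2)] unfolding normal_mono_def by blast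
    then obtain W where W: "W \<in> carrier (tensor R (M l) L)" "?tN k l ?X = ?f l W" by blast
    have "X = tensor_map R F N id f (?cL l W)"
      using tensor_map_cocone[OF N l(1) X'] Xeq W(2) comc[OF lI W(1)] by simp
    then show ?thesis using hom_in_carrier[OF cL[OF lI] W(1)] by blast
  qed
  ultimately show ?thesis unfolding normal_mono_def by blast
qed

end

text \<open>Injectivity of \<open>\<theta>\<close> reduces an equality in F to an equality of
  classes in the quotient, which by construction means agreement at a later stage.\<close>

lemma (in directed_system) directed_limit_lin_iso:
  assumes F: "right_semimodule R F" and \<theta>: "\<theta> \<in> lin_iso R (dirlim I r M \<phi>) F"
  shows "directed_limit R I r M \<phi> F (\<lambda>i x. \<theta> (dirlim_inj I r M \<phi> i x))"
proof -
  have lin: "\<theta> \<in> lin_hom R (dirlim I r M \<phi>) F"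
    and bij: "bij_betw \<theta> (carrier (dirlim I r M \<phi>)) (carrier F)"
    using \<theta> by (auto simp: lin_iso_def)
  show ?thesis
  proof (intro directed_limit.intro directed_limit_axioms.intro F directed_system_axioms)
    show "(\<lambda>x. \<theta> (dirlim_inj I r M \<phi> i x)) \<in> lin_hom R (M i) F" if "i \<in> I" for i
      by (rule lin_hom_comp[OF dirlim_inj_lin_hom[OF that] lin])
    show "\<theta> (dirlim_inj I r M \<phi> j (\<phi> i j x)) = \<theta> (dirlim_inj I r M \<phi> i x)"
      if "(i, j) \<in> r" "x \<in> carrier (M i)" for i j x
      by (simp add: dirlim_inj_trans[OF that])
    show "\<exists>i\<in>I. \<exists>x\<in>carrier (M i). \<theta> (dirlim_inj I r M \<phi> i x) = y" if y: "y \<in> carrier F" for y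
    proof -
      have "y \<in> \<theta> ` carrier (dirlim I r M \<phi>)" using bij y by (simp add: bij_betw_def)
      then show ?thesis by (auto simp: dirlim_carrier)
    qed
    show "\<exists>k. (i, k) \<in> r \<and> (j, k) \<in> r \<and> \<phi> i k x = \<phi> j k y"
      if "i \<in> I" "j \<in> I" "x \<in> carrier (M i)" "y \<in> carrier (M j)"
        "\<theta> (dirlim_inj I r M \<phi> i x) = \<theta> (dirlim_inj I r M \<phi> j y)" for i j x y
    proof -
      have "dirlim_inj I r M \<phi> i x = dirlim_inj I r M \<phi> j y"
        using that bij dirlim_inj_closed unfolding bij_betw_def inj_on_def by blast
      then show ?thesis using dirlim_inj_eq_iff[OF that(1-4)] by blast
    qed
  qed
qed


section \<open>Cokernels\<close>

text \<open>The derivation over N is lifted along id x g. Being equal up to terms from the image of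
  \<open>id \<otimes> f\<close> is itself a congruence over M; the generating relations lift to
  genuine ones after choosing preimages under g, and only pairs in the same fibre need the
  correction terms.\<close>

lemma tensor_cokernel:
  fixes R :: "('r, 'z) ring_scheme" and F :: "('r, 'f) module" and L :: "('r, 'l) module"
    and M :: "('r, 'm) module" and N :: "('r, 'n) module"
  assumes F: "right_semimodule R F"
    and L: "left_semimodule R L" and M: "left_semimodule R M" and N: "left_semimodule R N"
    and f: "f \<in> lin_hom R L M" and g: "g \<in> lin_hom R M N"
    and ex: "exact_at (add_monoid L) f (add_monoid M) g (add_monoid N)"
    and surj: "g ` carrier M = carrier N"
    and X: "X \<in> carrier (tensor R F M)" and Y: "Y \<in> carrier (tensor R F M)"
    and eq: "tensor_map R F N id g X = tensor_map R F N id g Y"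
  shows "\<exists>U\<in>carrier (tensor R F L). \<exists>V\<in>carrier (tensor R F L).
    X \<otimes>\<^bsub>tensor R F M\<^esub> tensor_map R F M id f U = Y \<otimes>\<^bsub>tensor R F M\<^esub> tensor_map R F M id f V"
proof -
  interpret M: left_semimodule R M by fact
  interpret N: left_semimodule R N by fact
  interpret FL: tensor_pair R F L by (intro tensor_pair.intro F L)
  interpret FM: tensor_pair R F M by (intro tensor_pair.intro F M)
  interpret FN: tensor_pair R F N by (intro tensor_pair.intro F N)
  interpret TL: comm_monoid "tensor R F L" by (rule FL.tensor_comm_monoid)
  interpret TM: comm_monoid "tensor R F M" by (rule FM.tensor_comm_monoid)
  let ?T = "tensor R F M"
  let ?f = "tensor_map R F M id f"
  let ?h = "map_prod id g :: 'f \<times> 'm \<Rightarrow> 'f \<times> 'n"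
  let ?D = "carrier F \<times> carrier M"
  note Tf = tensor_map_hom[OF FL.tensor_pair_axioms FM.tensor_pair_axioms id_lin_hom(1) f]
  have fC: "?f U \<in> carrier ?T" if "U \<in> carrier (tensor R F L)" for U
    using hom_in_carrier[OF Tf(1) that] .
  have clsC: "FM.cls A \<in> carrier ?T" if "set_mset A \<subseteq> ?D" for A
    using that by (auto simp: FM.tensor_carrier)
  define \<rho> where "\<rho> = (\<lambda>A B. \<exists>U\<in>carrier (tensor R F L). \<exists>V\<in>carrier (tensor R F L).
    FM.cls A \<otimes>\<^bsub>?T\<^esub> ?f U = FM.cls B \<otimes>\<^bsub>?T\<^esub> ?f V)"
  have \<rho>_cong: "\<rho> A B" if "(A, B) \<in> tensor_cong R F M" for A B
    using FM.cls_eq[OF that] unfolding \<rho>_def by (auto intro: TL.one_closed)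
  obtain A where A: "X = FM.cls A" "set_mset A \<subseteq> ?D" using X by (auto simp: FM.tensor_carrier)
  obtain B where B: "Y = FM.cls B" "set_mset B \<subseteq> ?D" using Y by (auto simp: FM.tensor_carrier)
  have lift: "\<exists>m\<in>carrier M. g m = n" if "n \<in> carrier N" for n
    using that unfolding surj[symmetric] by blast
  note clsN = tensor_map_cls[OF FM.tensor_pair_axioms FN.tensor_pair_axioms id_lin_hom(1) g]
  have "set_mset (image_mset ?h A) \<subseteq> carrier F \<times> carrier N"
    "set_mset (image_mset ?h B) \<subseteq> carrier F \<times> carrier N"
    using A(2) B(2) lin_homD(1)[OF g] by auto
  then have AB: "(image_mset ?h A, image_mset ?h B) \<in> tensor_cong R F N"
    using eq unfolding A(1) B(1) clsN[OF A(2)] clsN[OF B(2)]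
    by (simp add: FN.cls_eq_iff del: set_image_mset)
  have "\<rho> A B"
  proof (rule tensor_cong_lift[where h = ?h and D = ?D and \<rho> = \<rho> and R = R and F = F and N = N])
    show "carrier F \<times> carrier N \<subseteq> ?h ` ?D"
      using surj by (simp add: map_prod_surj_on)
    show "\<rho> {#} {#}" by (rule \<rho>_cong) (simp add: tensor_cong.refl)
    show "\<rho> B A" if "\<rho> A B" for A B using that unfolding \<rho>_def by metis
  next
    fix A B C assume *: "set_mset A \<subseteq> ?D" "set_mset B \<subseteq> ?D" "set_mset C \<subseteq> ?D" "\<rho> A B" "\<rho> B C"
    then obtain U V U' V' where UV: "U \<in> carrier (tensor R F L)" "V \<in> carrier (tensor R F L)"
      "U' \<in> carrier (tensor R F L)" "V' \<in> carrier (tensor R F L)"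
      "FM.cls A \<otimes>\<^bsub>?T\<^esub> ?f U = FM.cls B \<otimes>\<^bsub>?T\<^esub> ?f V" "FM.cls B \<otimes>\<^bsub>?T\<^esub> ?f U' = FM.cls C \<otimes>\<^bsub>?T\<^esub> ?f V'"
      unfolding \<rho>_def by blast
    \<comment> \<open>For transitivity the correction terms accumulate: U and U' on the side of A,
      V' and V on the side of C.\<close>
    have "FM.cls A \<otimes>\<^bsub>?T\<^esub> (?f U \<otimes>\<^bsub>?T\<^esub> ?f U') = FM.cls A \<otimes>\<^bsub>?T\<^esub> ?f U \<otimes>\<^bsub>?T\<^esub> ?f U'"
      using UV(1-4) * by (simp add: TM.m_assoc clsC fC)
    also have "\<dots> = FM.cls B \<otimes>\<^bsub>?T\<^esub> ?f U' \<otimes>\<^bsub>?T\<^esub> ?f V"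
      unfolding UV(5) using UV(1-4) * by (simp add: TM.m_ac clsC fC)
    also have "\<dots> = FM.cls C \<otimes>\<^bsub>?T\<^esub> (?f V' \<otimes>\<^bsub>?T\<^esub> ?f V)"
      unfolding UV(6) using UV(1-4) * by (simp add: TM.m_assoc clsC fC)
    finally show "\<rho> A C"
      unfolding \<rho>_def using UV(1-4) hom_mult[OF Tf(1)] TL.m_closed by metis
  next
    fix A B A' B' assume *: "set_mset A \<subseteq> ?D" "set_mset B \<subseteq> ?D" "set_mset A' \<subseteq> ?D" "set_mset B' \<subseteq> ?D"
      "\<rho> A B" "\<rho> A' B'"
    then obtain U V U' V' where UV: "U \<in> carrier (tensor R F L)" "V \<in> carrier (tensor R F L)"
      "U' \<in> carrier (tensor R F L)" "V' \<in> carrier (tensor R F L)"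
      "FM.cls A \<otimes>\<^bsub>?T\<^esub> ?f U = FM.cls B \<otimes>\<^bsub>?T\<^esub> ?f V" "FM.cls A' \<otimes>\<^bsub>?T\<^esub> ?f U' = FM.cls B' \<otimes>\<^bsub>?T\<^esub> ?f V'"
      unfolding \<rho>_def by blast
    have "FM.cls (A + A') \<otimes>\<^bsub>?T\<^esub> (?f U \<otimes>\<^bsub>?T\<^esub> ?f U')
      = (FM.cls A \<otimes>\<^bsub>?T\<^esub> ?f U) \<otimes>\<^bsub>?T\<^esub> (FM.cls A' \<otimes>\<^bsub>?T\<^esub> ?f U')"
      using UV(1-4) * by (simp add: FM.tensor_mult[symmetric] TM.m_ac clsC fC)
    also have "\<dots> = FM.cls (B + B') \<otimes>\<^bsub>?T\<^esub> (?f V \<otimes>\<^bsub>?T\<^esub> ?f V')"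
      unfolding UV(5,6) using UV(1-4) * by (simp add: FM.tensor_mult[symmetric] TM.m_ac clsC fC)
    finally show "\<rho> (A + A') (B + B')"
      unfolding \<rho>_def using UV(1-4) hom_mult[OF Tf(1)] TL.m_closed by metis
  next
    fix p q assume pq: "p \<in> ?D" "q \<in> ?D" "?h p = ?h q"
    obtain x m m' where p: "p = (x, m)" "q = (x, m')" using pq(3) by (cases p; cases q) auto
    have *: "x \<in> carrier F" "m \<in> carrier M" "m' \<in> carrier M" "g m = g m'"
      using pq by (auto simp: p)
    have "kernel (add_monoid M) (add_monoid N) g = f ` carrier L"
      "k_uniform (add_monoid M) (add_monoid N) g"
      using ex by (auto simp: exact_at_def)
    \<comment> \<open>Here exactness at M enters: elements with the same image under g agree after
      adding kernel elements, and these lie in the image of f. Tensoring with x then relates the two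
      pairs.\<close>
    then obtain u v where uv: "u \<in> carrier L" "v \<in> carrier L" "m \<oplus>\<^bsub>M\<^esub> f u = m' \<oplus>\<^bsub>M\<^esub> f v"
      using * unfolding k_uniform_def by (simp, metis)
    have "pure_tensor R F M x m \<otimes>\<^bsub>?T\<^esub> ?f (pure_tensor R F L x u)
      = pure_tensor R F M x m' \<otimes>\<^bsub>?T\<^esub> ?f (pure_tensor R F L x v)"
      using uv * lin_homD(1)[OF f] Tf(3)[OF *(1)]
      by (simp flip: FM.pure_tensor_add_right)
    then show "\<rho> {#p#} {#q#}"
      unfolding \<rho>_def p using uv * FL.pure_tensor_closed unfolding pure_tensor_def by blast
  next
    fix x y n assume xy: "x \<in> carrier F" "y \<in> carrier F" and n: "n \<in> carrier N"
    obtain m where m: "m \<in> carrier M" "g m = n" using lift[OF n] by blast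
    show "\<exists>p\<in>?D. \<exists>q\<in>?D. \<exists>s\<in>?D. ?h p = (x \<oplus>\<^bsub>F\<^esub> y, n) \<and> ?h q = (x, n) \<and> ?h s = (y, n) \<and> \<rho> {#p#} {#q, s#}"
      using xy m \<rho>_cong[OF tensor_cong.add_left[OF xy m(1)]]
      by (intro bexI[of _ "(x \<oplus>\<^bsub>F\<^esub> y, m)"] bexI[of _ "(x, m)"] bexI[of _ "(y, m)"]) auto
  next
    fix n assume n: "n \<in> carrier N"
    obtain m where m: "m \<in> carrier M" "g m = n" using lift[OF n] by blast
    show "\<exists>p\<in>?D. ?h p = (\<zero>\<^bsub>F\<^esub>, n) \<and> \<rho> {#p#} {#}"
      using m \<rho>_cong[OF tensor_cong.zero_left[OF m(1)]] by (intro bexI[of _ "(\<zero>\<^bsub>F\<^esub>, m)"]) auto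
  next
    fix x n n' assume x: "x \<in> carrier F" and n: "n \<in> carrier N" "n' \<in> carrier N"
    obtain m where m: "m \<in> carrier M" "g m = n" using lift[OF n(1)] by blast
    obtain m' where m': "m' \<in> carrier M" "g m' = n'" using lift[OF n(2)] by blast
    show "\<exists>p\<in>?D. \<exists>q\<in>?D. \<exists>s\<in>?D. ?h p = (x, n \<oplus>\<^bsub>N\<^esub> n') \<and> ?h q = (x, n) \<and> ?h s = (x, n') \<and> \<rho> {#p#} {#q, s#}"
      using x m m' lin_homD(2)[OF g m(1) m'(1)] \<rho>_cong[OF tensor_cong.add_right[OF x m(1) m'(1)]]
      by (intro bexI[of _ "(x, m \<oplus>\<^bsub>M\<^esub> m')"] bexI[of _ "(x, m)"] bexI[of _ "(x, m')"]) auto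
  next
    fix x assume x: "x \<in> carrier F"
    show "\<exists>p\<in>?D. ?h p = (x, \<zero>\<^bsub>N\<^esub>) \<and> \<rho> {#p#} {#}"
      using x \<rho>_cong[OF tensor_cong.zero_right[OF x]]
        lin_hom_zero[OF g M.presemimodule_axioms N.presemimodule_axioms]
      by (intro bexI[of _ "(x, \<zero>\<^bsub>M\<^esub>)"]) auto
  next
    fix a x n assume a: "a \<in> carrier R" and x: "x \<in> carrier F" and n: "n \<in> carrier N"
    obtain m where m: "m \<in> carrier M" "g m = n" using lift[OF n] by blast
    show "\<exists>p\<in>?D. \<exists>q\<in>?D. ?h p = (a \<odot>\<^bsub>F\<^esub> x, n) \<and> ?h q = (x, a \<odot>\<^bsub>N\<^esub> n) \<and> \<rho> {#p#} {#q#}"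
      using a x m lin_homD(3)[OF g a m(1)] \<rho>_cong[OF tensor_cong.balance[OF a x m(1)]]
      by (intro bexI[of _ "(a \<odot>\<^bsub>F\<^esub> x, m)"] bexI[of _ "(x, a \<odot>\<^bsub>M\<^esub> m)"]) auto
  qed (fact A(2) B(2) AB)+
  then show ?thesis unfolding \<rho>_def A(1) B(1) .
qed

section \<open>Exactness of the tensored sequence\<close>

lemma tensor_short_exact:
  fixes R :: "('r, 'z) ring_scheme" and F :: "('r, 'f) module" and L :: "('r, 'l) module"
    and M :: "('r, 'm) module" and N :: "('r, 'n) module"
  assumes F: "right_semimodule R F"
    and L: "left_semimodule R L" and M: "left_semimodule R M" and N: "left_semimodule R N"
    and f: "f \<in> lin_hom R L M" and g: "g \<in> lin_hom R M N"
    and ex: "short_exact (add_monoid L) f (add_monoid M) g (add_monoid N)"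
    and nm: "normal_mono (tensor R F L) (tensor R F M) (tensor_map R F M id f)"
  shows "short_exact (tensor R F L) (tensor_map R F M id f) (tensor R F M)
    (tensor_map R F N id g) (tensor R F N)"
proof -
  interpret FL: tensor_pair R F L by (intro tensor_pair.intro F L)
  interpret FM: tensor_pair R F M by (intro tensor_pair.intro F M)
  interpret FN: tensor_pair R F N by (intro tensor_pair.intro F N)
  interpret TM: comm_monoid "tensor R F M" by (rule FM.tensor_comm_monoid)
  interpret TN: comm_monoid "tensor R F N" by (rule FN.tensor_comm_monoid)
  let ?f = "tensor_map R F M id f" and ?g = "tensor_map R F N id g"
  note Tf = tensor_map_hom[OF FL.tensor_pair_axioms FM.tensor_pair_axioms id_lin_hom(1) f]
  note Tg = tensor_map_hom[OF FM.tensor_pair_axioms FN.tensor_pair_axioms id_lin_hom(1) g]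
  have exM: "exact_at (add_monoid L) f (add_monoid M) g (add_monoid N)"
    and surj: "g ` carrier M = carrier N"
    using ex by (auto simp: short_exact_def exact_at_def kernel_def)
  have gf: "g (f u) = \<zero>\<^bsub>N\<^esub>" if "u \<in> carrier L" for u
    using exM that by (auto simp: exact_at_def kernel_def)
  \<comment> \<open>On a pure tensor the right factor becomes g (f n) = 0; additivity does the
    rest.\<close>
  have Tgf: "?g (?f U) = \<one>\<^bsub>tensor R F N\<^esub>" if "U \<in> carrier (tensor R F L)" for U
    using that
  proof (induction rule: FL.tensor_induct)
    case one
    show ?case by (simp only: Tf(2) Tg(2))
  next
    case (pure x n Y)
    have n: "f n \<in> carrier M" by (rule lin_homD(1)[OF f pure(2)])
    have "?g (?f (pure_tensor R F L x n \<otimes>\<^bsub>tensor R F L\<^esub> Y))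
      = ?g (?f (pure_tensor R F L x n)) \<otimes>\<^bsub>tensor R F N\<^esub> ?g (?f Y)"
      using pure hom_mult[OF Tf(1)] hom_mult[OF Tg(1)] hom_in_carrier[OF Tf(1)] by simp
    also have "?g (?f (pure_tensor R F L x n)) = \<one>\<^bsub>tensor R F N\<^esub>"
      using pure Tf(3)[OF pure(1,2)] Tg(3)[OF pure(1) n] gf[OF pure(2)] FN.pure_tensor_zero_right
      by simp
    finally show ?case using pure by simp
  qed
  \<comment> \<open>A pure tensor lifts by choosing a preimage of its right factor, and the image is
    closed under addition.\<close>
  have "carrier (tensor R F N) \<subseteq> ?g ` carrier (tensor R F M)"
  proof
    fix X assume "X \<in> carrier (tensor R F N)"
    then show "X \<in> ?g ` carrier (tensor R F M)"
    proof (induction rule: FN.tensor_induct)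
      case one
      show ?case using Tg(2) TM.one_closed by (metis imageI)
    next
      case (pure x n Y)
      from pure(2) obtain m where m: "m \<in> carrier M" "g m = n"
        unfolding surj[symmetric] by blast
      from pure(4) obtain Z where Z: "Z \<in> carrier (tensor R F M)" "Y = ?g Z" by blast
      have "pure_tensor R F N x n \<otimes>\<^bsub>tensor R F N\<^esub> Y = ?g (pure_tensor R F M x m \<otimes>\<^bsub>tensor R F M\<^esub> Z)"
        using hom_mult[OF Tg(1) _ Z(1)] pure m Z Tg(3)[OF pure(1) m(1)] by simp
      then show ?case using pure m Z by blast
    qed
  qed
  then have Tsurj: "?g ` carrier (tensor R F M) = carrier (tensor R F N)"
    using hom_in_carrier[OF Tg(1)] by auto
  show ?thesis
    by (rule normal_mono_short_exact[OF FL.tensor_comm_monoid FM.tensor_comm_monoid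
          FN.tensor_comm_monoid nm Tf(1,2) Tg(1,2) Tsurj Tgf
          tensor_cokernel[OF F L M N f g exM surj]])
qed

theorem corollary3p24:
  fixes S :: "('s, 'z) ring_scheme" and F :: "('s, 'f) module"
  assumes "semiring S" and "\<one>\<^bsub>S\<^esub> \<noteq> \<zero>\<^bsub>S\<^esub>"
    and "flat TYPE('i \<times> 'c) S F"
  shows "uniformly_flat TYPE('l \<times> 'm \<times> 'n) S F"
proof -
  obtain I :: "'i set" and r and P :: "'i \<Rightarrow> ('s, 'c) module" and \<phi> \<theta>
    where F: "right_semimodule S F" and sys: "directed_system S I r P \<phi>"
      and P: "\<And>i. i \<in> I \<Longrightarrow> finitely_presented S (P i) \<and> projective S (P i)"
      and \<theta>: "\<theta> \<in> lin_iso S (dirlim I r P \<phi>) F"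
    using assms(3) unfolding flat_def by blast
  \<comment> \<open>The isomorphism is absorbed into the cocone, so F itself plays the part of the
    limit.\<close>
  interpret directed_limit S I r P \<phi> F "\<lambda>i x. \<theta> (dirlim_inj I r P \<phi> i x)"
    by (rule directed_system.directed_limit_lin_iso[OF sys F \<theta>])
  show ?thesis
    unfolding uniformly_flat_def
  proof (intro conjI allI impI F, elim conjE)
    fix L :: "('s, 'l) module" and M :: "('s, 'm) module" and N :: "('s, 'n) module" and f g
    assume L: "left_semimodule S L" and M: "left_semimodule S M" and N: "left_semimodule S N"
      and f: "f \<in> lin_hom S L M" and g: "g \<in> lin_hom S M N"
      and ex: "short_exact (add_monoid L) f (add_monoid M) g (add_monoid N)"
    have add: "comm_monoid (add_monoid Q)" if "left_semimodule S Q" for Q :: "('s, 'q) module"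
      using that by (simp add: left_semimodule_def presemimodule_def abelian_monoid_def)
    have "normal_mono (add_monoid L) (add_monoid M) f"
      by (rule short_exact_normal_mono[OF ex add[OF L] add[OF M] add[OF N]])
        (use g in \<open>simp add: lin_hom_def\<close>)
    then have "normal_mono (tensor S F L) (tensor S F M) (tensor_map S F M id f)"
      using projective_normal_mono P L M f by (intro tensor_normal_mono) blast+
    then show "short_exact (tensor S F L) (tensor_map S F M id f) (tensor S F M)
        (tensor_map S F N id g) (tensor S F N)"
      by (rule tensor_short_exact[OF F L M N f g ex])
  qed
qed

end
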